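(* Let $\lambda=(\lambda_1,\dots,\lambda_k)\in\mathbb{C}^k$ satisfy $\|\lambda\|^2=1$. Let $(m_1,\dots,m_k)$ be a $k$-tuple of distinct non-negative integers. Let $f$ be the proper map (with source $\mathbb{B}^n$) defined by $$f(z)=J_\lambda(z^{\otimes m_1},\dots,z^{\otimes m_k})=\lambda_1z^{\otimes m_1}\oplus\cdots\oplus\lambda_kz^{\otimes m_k}.$$ Then: (1) Suppose $f(z)=z$. Then $\Gamma_f=\mathrm{Aut}(\mathbb{B}^n)$. (2) For $m\ge 2$, put $f(z)=z^{\otimes m}$. Then $\Gamma_f=\mathbf{U}(n)$. (3) If some $m_j\ge 2$, then $\Gamma_f=\mathbf{U}(n)$. (4) If $k=2$ and $(m_1,m_2)=(0,1)$, then $\Gamma_f=\mathrm{Aut}(\mathbb{B}^n)$. (5) In all these cases, the source rank satisfies $\mathbf{s}(f)=1$.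
   Context: $\mathbb{B}^n$ is the open unit ball of $\mathbb{C}^n$, $\mathrm{Aut}(\mathbb{B}^n)$ is its group of holomorphic automorphisms, and $\mathbf{U}(n)\leqslant\mathrm{Aut}(\mathbb{B}^n)$ is the unitary group. For a rational proper map $f:\mathbb{B}^n\to\mathbb{B}^N$, the Hermitian invariant group is $$\Gamma_f=\{\gamma\in\mathrm{Aut}(\mathbb{B}^n):\ \text{there is } \psi\in\mathrm{Aut}(\mathbb{B}^N)\text{ with } f\circ\gamma=\psi\circ f\}.$$ $z^{\otimes m}$ is the $m$-fold tensor power of the identity map, a homogeneous polynomial map with $\|z^{\otimes m}\|^2=\|z\|^{2m}$ ($z^{\otimes 0}=1$), and $\oplus$ is orthogonal sum. For $\lambda\in\mathbb{C}^k$ with $\|\lambda\|^2=1$ and maps $g_1,\dots,g_k$ with the same source, the juxtaposition is $J_\lambda(g_1,\dots,g_k)=\lambda_1g_1\oplus\cdots\oplus\lambda_kg_k$. Source rank: for integers $k_j\ge 0$ with $\sum k_j\le n$, consider the block-diagonal subgroup $G=\mathbf{U}(k_1)\oplus\cdots\oplus\mathbf{U}(k_J)$ of $\mathbf{U}(n)$ (acting as the identity on the remaining $n-\sum k_j$ coordinates; $\mathbf{U}(0)$ is trivial), and put $\mathbf{S}(G)=n-\sum_{k_j\ge1}(k_j-1)$. For a subgroup $\Gamma\leqslant\mathrm{Aut}(\mathbb{B}^n)$, $\mathbf{S}(\Gamma)$ is the minimum of $\mathbf{S}(G)$ over all such $G\leqslant\Gamma$. The source rank of $f$ is $\mathbf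{s}(f)=\min_{\phi\in\mathrm{Aut}(\mathbb{B}^n)}\mathbf{S}(\phi^{-1}\circ\Gamma_f\circ\phi)$.
   Formalization: In (3), and in (5) for that case, some m_j ≥ 2 must have λ_j ≠ 0: for λ=(1,0), m=(1,2), f = z ⊕ 0 has Γ_f = Aut(B^n). Properness of f is assumed, which excludes only constant f (e.g. λ_2 = 0 in (4)). *)

theory Defs
  imports "HOL-Analysis.Analysis"
begin

section \<open>Automorphisms of the unit ball\<close>

text \<open>The space \<open>\<complex>\<^sup>n\<close> is \<^typ>\<open>complex^'n\<close>, whose norm is the Hermitian one; the open unit ball
  is \<^term>\<open>ball 0 1\<close>. Complex differentiability at every point means real
  Frechet differentiability with a complex linear derivative.\<close>

definition holomorphic_map_on :: "(complex^'a \<Rightarrow> complex^'b) \<Rightarrow> (complex^'a) set \<Rightarrow> bool"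
  where "holomorphic_map_on f S \<longleftrightarrow>
    (\<forall>p\<in>S. \<exists>L. (f has_derivative L) (at p within S) \<and> (\<forall>c v. L (c *s v) = c *s L v))"

text \<open>Maps with source the ball are represented by \<^const>\<open>extensional\<close> functions whenever sets
  of such maps are to be compared.\<close>

definition ball_aut :: "(complex^'n \<Rightarrow> complex^'n) set"
  where "ball_aut = {\<phi> \<in> extensional (ball 0 1).
    bij_betw \<phi> (ball 0 1) (ball 0 1) \<and>
    holomorphic_map_on \<phi> (ball 0 1) \<and>
    holomorphic_map_on (inv_into (ball 0 1) \<phi>) (ball 0 1)}"

definition proper_holomorphic_ball_map :: "(complex^'n \<Rightarrow> complex^'N) \<Rightarrow> bool"
  where "proper_holomorphic_ball_map f \<longleftrightarrow>
    holomorphic_map_on f (ball 0 1) \<and>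
    proper_map (top_of_set (ball 0 1)) (top_of_set (ball 0 1)) f"

definition hermitian_group :: "(complex^'n \<Rightarrow> complex^'N) \<Rightarrow> (complex^'n \<Rightarrow> complex^'n) set"
  where "hermitian_group f =
    {\<gamma> \<in> ball_aut. \<exists>\<psi>\<in>ball_aut. \<forall>z\<in>ball 0 1. f (\<gamma> z) = \<psi> (f z)}"

section \<open>Unitary groups\<close>

definition conjugate_transpose :: "complex^'n^'m \<Rightarrow> complex^'m^'n"
  where "conjugate_transpose A = (\<chi> i j. cnj (A $ j $ i))"

definition unitary_matrix :: "complex^'n^'n \<Rightarrow> bool"
  where "unitary_matrix A \<longleftrightarrow>
    conjugate_transpose A ** A = mat 1 \<and> A ** conjugate_transpose A = mat 1"

definition linear_ball_map :: "complex^'n^'n \<Rightarrow> complex^'n \<Rightarrow> complex^'n"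
  where "linear_ball_map A = restrict (\<lambda>z. A *v z) (ball 0 1)"

definition unitary_group :: "(complex^'n \<Rightarrow> complex^'n) set"
  where "unitary_group = linear_ball_map ` {A. unitary_matrix A}"

text \<open>The coordinates of \<open>\<complex>\<^sup>n\<close> are ordered by the order of the index type. The block numbered \<open>j\<close>
  of a list \<open>ks\<close> consists of the \<open>ks ! j\<close> consecutive coordinates following the blocks with smaller
  number; both are counted from 0.\<close>

definition coord_pos :: "'n::{finite,linorder} \<Rightarrow> nat"
  where "coord_pos i = card {l. l < i}"

definition block :: "nat list \<Rightarrow> nat \<Rightarrow> 'n::{finite,linorder} set"
  where "block ks j =
    {i. sum_list (take j ks) \<le> coord_pos i \<and> coord_pos i < sum_list (take (Suc j) ks)}"

text \<open>The group \<open>\<^bold>U(k\<^sub>1) \<oplus> \<dots> \<oplus> \<^bold>U(k\<^sub>J)\<close>: outside the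
  square blocks along the diagonal, the matrix agrees with the identity matrix.\<close>

definition block_unitary_group ::
    "nat list \<Rightarrow> (complex^'n::{finite,linorder} \<Rightarrow> complex^'n::{finite,linorder}) set"
  where "block_unitary_group ks = linear_ball_map ` {A. unitary_matrix A \<and>
    (\<forall>i l. (\<exists>j<length ks. i \<in> block ks j \<and> l \<in> block ks j) \<or> A $ i $ l = mat 1 $ i $ l)}"

section \<open>Source rank\<close>

text \<open>The minima are over nonempty sets of natural numbers. For \<open>sum_list ks \<le> n\<close> the subtraction
  from \<open>n\<close> is not truncated.\<close>

definition block_source_rank :: "nat \<Rightarrow> nat list \<Rightarrow> nat"
  where "block_source_rank n ks = n - (\<Sum>k\<leftarrow>filter (\<lambda>k. k \<ge> 1) ks. k - 1)"

definition group_source_rank :: "(complex^'n::{finite,linorder} \<Rightarrow> complex^'n::{finite,linorder}) set \<Rightarrow> nat"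
  where "group_source_rank \<Gamma> = (LEAST s. \<exists>ks. sum_list ks \<le> CARD('n) \<and>
    block_unitary_group ks \<subseteq> \<Gamma> \<and> s = block_source_rank CARD('n) ks)"

definition conjugate_group ::
    "(complex^'n \<Rightarrow> complex^'n) \<Rightarrow> (complex^'n \<Rightarrow> complex^'n) set \<Rightarrow> (complex^'n \<Rightarrow> complex^'n) set"
  where "conjugate_group \<phi> \<Gamma> =
    (\<lambda>\<gamma>. compose (ball 0 1) (inv_into (ball 0 1) \<phi>) (compose (ball 0 1) \<gamma> \<phi>)) ` \<Gamma>"

definition source_rank :: "(complex^'n::{finite,linorder} \<Rightarrow> complex^'N) \<Rightarrow> nat"
  where "source_rank f = (LEAST s. \<exists>\<phi>\<in>ball_aut.
    s = group_source_rank (conjugate_group \<phi> (hermitian_group f)))"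

section \<open>Tensor powers and juxtaposition\<close>

text \<open>The orthonormal basis vectors \<open>e\<^sub>i\<^sub>1 \<otimes> \<dots> \<otimes> e\<^sub>i\<^sub>m\<close> of the \<open>m\<close>-fold tensor
  power of \<open>\<complex>\<^sup>n\<close> are indexed by the words \<open>[i\<^sub>1, \<dots>, i\<^sub>m]\<close>, and elements of
  the tensor power are given by their coordinates. An orthogonal sum is indexed by pairs of the
  number of a summand (counted from 0) and an index in that summand.\<close>

definition words :: "nat \<Rightarrow> 'n list set"
  where "words m = {w. length w = m}"

definition tensor_power :: "nat \<Rightarrow> complex^'n \<Rightarrow> 'n list \<Rightarrow> complex"
  where "tensor_power m z = (\<lambda>w\<in>words m. \<Prod>i\<leftarrow>w. z $ i)"

definition juxtaposition ::
    "(nat \<Rightarrow> complex) \<Rightarrow> (nat \<Rightarrow> 'z \<Rightarrow> 'i \<Rightarrow> complex) \<Rightarrow> 'z \<Rightarrow> nat \<times> 'i \<Rightarrow> complex"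
  where "juxtaposition lam g z = (\<lambda>(j, w). lam j * g j z w)"

definition juxtaposition_index :: "nat \<Rightarrow> (nat \<Rightarrow> nat) \<Rightarrow> (nat \<times> 'n list) set"
  where "juxtaposition_index k m = (SIGMA j:{..<k}. words (m j))"

text \<open>Identification of the vectors with coordinates indexed by \<open>I\<close> with \<open>\<complex>\<^sup>N\<close>, for an enumeration
  \<open>e\<close> of the index set \<open>I\<close> by the \<open>N\<close> indices.\<close>

definition enumerate_coords :: "'i set \<Rightarrow> ('i \<Rightarrow> 'N) \<Rightarrow> ('i \<Rightarrow> complex) \<Rightarrow> complex^'N"
  where "enumerate_coords I e v = (\<chi> a. v (inv_into I e a))"

definition tensor_map :: "nat \<Rightarrow> ('n list \<Rightarrow> 'M) \<Rightarrow> complex^'n \<Rightarrow> complex^'M"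
  where "tensor_map d e z = enumerate_coords (words d) e (tensor_power d z)"

definition tensor_juxtaposition :: "nat \<Rightarrow> (nat \<Rightarrow> complex) \<Rightarrow> (nat \<Rightarrow> nat) \<Rightarrow>
    (nat \<times> 'n list \<Rightarrow> 'N) \<Rightarrow> complex^'n \<Rightarrow> complex^'N"
  where "tensor_juxtaposition k lam m e z = enumerate_coords (juxtaposition_index k m) e
    (juxtaposition lam (\<lambda>j. tensor_power (m j)) z)"

lemma sum_words_prod_list:
  fixes a :: "'n::finite \<Rightarrow> real"
  shows "(\<Sum>w\<in>words d. prod_list (map a w)) = (\<Sum>i\<in>UNIV. a i) ^ d"
proof (induction d)
  case 0
  then show ?case by (simp add: words_def)
next
  case (Suc d)
  have "words (Suc d) = (\<lambda>(i, w). i # w) ` (UNIV \<times> (words d :: 'n list set))"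
    by (auto simp: words_def length_Suc_conv image_iff)
  moreover have "inj_on (\<lambda>(i, w). i # w) (UNIV \<times> (words d :: 'n list set))"
    by (auto simp: inj_on_def)
  ultimately have "(\<Sum>w\<in>words (Suc d). prod_list (map a w)) =
      (\<Sum>(i, w)\<in>UNIV \<times> words d. a i * prod_list (map a w))"
    by (simp only: sum.reindex) (simp add: case_prod_beta)
  also have "\<dots> = (\<Sum>i\<in>UNIV. a i) * (\<Sum>w\<in>words d. prod_list (map a w))"
    by (simp add: sum_product sum.cartesian_product)
  finally show ?case using Suc by simp
qed

lemma finite_words: "finite (words d :: 'n::finite list set)"
  using finite_lists_length_eq[of "UNIV :: 'n set" d] by (simp add: words_def)

lemma norm_tensor_juxtaposition:
  fixes z :: "complex^'n" and e :: "nat \<times> 'n list \<Rightarrow> 'N::finite"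
  assumes "bij_betw e (juxtaposition_index k m) UNIV"
  shows "(norm (tensor_juxtaposition k lam m e z))\<^sup>2 =
    (\<Sum>j<k. (cmod (lam j))\<^sup>2 * (norm z) ^ (2 * m j))"
proof -
  let ?I = "juxtaposition_index k m :: (nat \<times> 'n list) set"
  let ?v = "juxtaposition lam (\<lambda>j. tensor_power (m j)) z"
  have cm: "(cmod (prod_list (map (($) z) w)))\<^sup>2 = prod_list (map (\<lambda>i. (cmod (z $ i))\<^sup>2) w)" for w
    by (induction w) (auto simp: norm_mult power_mult_distrib)
  have nz: "(norm z)\<^sup>2 = (\<Sum>i\<in>UNIV. (cmod (z $ i))\<^sup>2)"
    by (simp add: norm_vec_def L2_set_def sum_nonneg)
  have "(norm (tensor_juxtaposition k lam m e z))\<^sup>2 = (\<Sum>a\<in>UNIV. (cmod (?v (inv_into ?I e a)))\<^sup>2)"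
    by (simp add: norm_vec_def L2_set_def sum_nonneg tensor_juxtaposition_def enumerate_coords_def)
  also have "\<dots> = (\<Sum>p\<in>?I. (cmod (?v p))\<^sup>2)"
    by (rule sum.reindex_bij_betw[OF bij_betw_inv_into[OF assms]])
  also have "\<dots> = (\<Sum>j<k. \<Sum>w\<in>words (m j). (cmod (?v (j, w)))\<^sup>2)"
    unfolding juxtaposition_index_def
    by (subst sum.Sigma) (auto simp: finite_words case_prod_beta)
  also have "\<dots> = (\<Sum>j<k. (cmod (lam j))\<^sup>2 * (\<Sum>w\<in>words (m j). prod_list (map (\<lambda>i. (cmod (z $ i))\<^sup>2) w)))"
    by (intro sum.cong refl)
      (auto simp: juxtaposition_def tensor_power_def norm_mult power_mult_distrib cm sum_distrib_left)
  finally show ?thesis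
    by (simp add: sum_words_prod_list flip: nz power_mult)
qed

lemma holomorphic_tensor_juxtaposition:
  fixes e :: "nat \<times> 'n::finite list \<Rightarrow> 'N::finite"
  assumes "bij_betw e (juxtaposition_index k m) UNIV"
  shows "holomorphic_map_on (tensor_juxtaposition k lam m e) S"
  unfolding holomorphic_map_on_def
proof
  fix p :: "complex^'n"
  have mono: "\<exists>L. ((\<lambda>z :: complex^'n. prod_list (map (($) z) w)) has_derivative L) (at p within S) \<and>
      (\<forall>c v. L (c *s v) = c * L v)" for w
  proof (induction w)
    case Nil
    show ?case by (rule exI[of _ "\<lambda>_. 0"]) simp
  next
    case (Cons i w)
    then obtain L where L: "((\<lambda>z :: complex^'n. prod_list (map (($) z) w)) has_derivative L) (at p within S)"
      "\<And>c v. L (c *s v) = c * L v" by auto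
    have "((\<lambda>z :: complex^'n. z $ i) has_derivative (\<lambda>h. h $ i)) (at p within S)"
      by (rule bounded_linear_imp_has_derivative) (rule bounded_linear_vec_nth)
    from has_derivative_mult[OF this L(1)] show ?case
      by (intro exI[of _ "\<lambda>h. p $ i * L h + h $ i * prod_list (map (($) p) w)"])
        (auto simp: L(2) algebra_simps)
  qed
  define W where "W a = inv_into (juxtaposition_index k m) e a" for a
  have W: "length (snd (W a)) = m (fst (W a))" for a
  proof -
    have "W a \<in> juxtaposition_index k m"
      unfolding W_def using bij_betwE[OF bij_betw_inv_into[OF assms]] by blast
    then show ?thesis by (auto simp: juxtaposition_index_def words_def)
  qed
  from mono obtain L where L: "\<And>w. ((\<lambda>z :: complex^'n. prod_list (map (($) z) w)) has_derivative L w) (at p within S)"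
      "\<And>w c v. L w (c *s v) = c * L w v"
    by metis
  have eq: "tensor_juxtaposition k lam m e = (\<lambda>z. \<Sum>a\<in>UNIV. axis a (lam (fst (W a)) * prod_list (map (($) z) (snd (W a)))))"
    using W by (auto simp: fun_eq_iff vec_eq_iff tensor_juxtaposition_def enumerate_coords_def axis_def
        juxtaposition_def tensor_power_def words_def case_prod_beta simp flip: W_def)
  have ax: "bounded_linear (axis a :: complex \<Rightarrow> complex^'N)" for a
    by (intro linear_conv_bounded_linear[THEN iffD1] linearI)
      (auto simp: axis_def vec_eq_iff)
  let ?L = "\<lambda>h. \<Sum>a\<in>UNIV. axis a (lam (fst (W a)) * L (snd (W a)) h) :: complex^'N"
  have "(tensor_juxtaposition k lam m e has_derivative ?L) (at p within S)"
    unfolding eq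
    by (intro has_derivative_sum bounded_linear.has_derivative[OF ax] has_derivative_mult_right L(1))
  moreover have "?L (c *s v) = c *s ?L v" for c v
    by (auto simp: L(2) vec_eq_iff axis_def if_distrib algebra_simps cong: if_cong)
  ultimately show "\<exists>L. (tensor_juxtaposition k lam m e has_derivative L) (at p within S) \<and>
      (\<forall>c v. L (c *s v) = c *s L v)" by blast
qed

text \<open>A juxtaposition of tensor powers is a proper map between balls unless it is constant.\<close>

lemma proper_tensor_juxtaposition_iff:
  fixes e :: "nat \<times> 'n::finite list \<Rightarrow> 'N::finite"
  assumes lam: "(\<Sum>j<k. (cmod (lam j))\<^sup>2) = 1"
    and e: "bij_betw e (juxtaposition_index k m) UNIV"
  shows "proper_holomorphic_ball_map (tensor_juxtaposition k lam m e) \<longleftrightarrow>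
    (\<exists>j<k. lam j \<noteq> 0 \<and> 0 < m j)" (is "?P \<longleftrightarrow> ?Q")
proof
  let ?f = "tensor_juxtaposition k lam m e"
  assume ?P
  then have "?f 0 \<in> ball 0 1"
    using proper_map_imp_subset_topspace by (fastforce simp: proper_holomorphic_ball_map_def)
  then have *: "(norm (?f 0))\<^sup>2 < 1" by (simp add: power_less_one_iff)
  show ?Q
  proof (rule ccontr)
    assume "\<not> ?Q"
    then have "(cmod (lam j))\<^sup>2 * norm (0 :: complex^'n) ^ (2 * m j) = (cmod (lam j))\<^sup>2" if "j < k" for j
      using that by auto
    then have "(\<Sum>j<k. (cmod (lam j))\<^sup>2 * norm (0 :: complex^'n) ^ (2 * m j)) = 1"
      unfolding lam[symmetric] by (intro sum.cong) auto
    then have "(norm (?f 0))\<^sup>2 = 1"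
      by (simp only: norm_tensor_juxtaposition[OF e])
    with * show False by simp
  qed
next
  let ?f = "tensor_juxtaposition k lam m e"
  assume ?Q
  then obtain j0 where j0: "j0 < k" "lam j0 \<noteq> 0" "0 < m j0" by blast
  have bdry: "norm (?f z) = 1" if "norm z = 1" for z
  proof -
    have "(norm (?f z))\<^sup>2 = 1" using lam that by (simp add: norm_tensor_juxtaposition[OF e])
    then show ?thesis by (simp add: power2_eq_1_iff) (metis norm_ge_zero not_one_le_zero neg_0_le_iff_le)
  qed
  have int: "norm (?f z) < 1" if "norm z < 1" for z
  proof -
    have "(\<Sum>j<k. (cmod (lam j))\<^sup>2 * norm z ^ (2 * m j)) < (\<Sum>j<k. (cmod (lam j))\<^sup>2)"
    proof (rule sum_strict_mono_ex1)
      show "\<forall>j\<in>{..<k}. (cmod (lam j))\<^sup>2 * norm z ^ (2 * m j) \<le> (cmod (lam j))\<^sup>2"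
        using that by (auto intro!: mult_left_le power_le_one)
      have "norm z ^ (2 * m j0) < 1"
        using that j0 by (simp add: power_less_one_iff)
      then show "\<exists>j\<in>{..<k}. (cmod (lam j))\<^sup>2 * norm z ^ (2 * m j) < (cmod (lam j))\<^sup>2"
        using j0 by (intro bexI[of _ j0]) auto
    qed auto
    then show ?thesis by (simp add: lam power_less_one_iff flip: norm_tensor_juxtaposition[OF e])
  qed
  have cont: "continuous_on S ?f" for S
    using holomorphic_tensor_juxtaposition[OF e, of lam S]
    unfolding holomorphic_map_on_def continuous_on_eq_continuous_within
    by (metis has_derivative_continuous)
  have "proper_map (top_of_set (ball 0 1)) (top_of_set (ball 0 1)) ?f"
  proof (rule compact_imp_proper_map)
    show "k_space (top_of_set (ball (0::complex^'N) 1))"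
      by (rule metrizable_imp_k_space[OF metrizable_space_subtopology[OF metrizable_space_euclidean]])
    show "kc_space (top_of_set (ball (0::complex^'N) 1))"
      by (simp add: Hausdorff_imp_kc_space Hausdorff_space_subtopology)
    show "?f \<in> topspace (top_of_set (ball 0 1)) \<rightarrow> topspace (top_of_set (ball 0 1))"
      using int by auto
    show "continuous_map (top_of_set (ball 0 1)) (top_of_set (ball 0 1)) ?f \<or> kc_space (top_of_set (ball (0::complex^'n) 1))"
      by (simp add: Hausdorff_imp_kc_space Hausdorff_space_subtopology)
    fix K :: "(complex^'N) set" assume "compactin (top_of_set (ball 0 1)) K"
    then have K: "compact K" "K \<subseteq> ball 0 1" by (auto simp: compactin_subtopology)
    have "{z \<in> ball 0 1. ?f z \<in> K} = cball 0 1 \<inter> ?f -` K"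
    proof (intro equalityI subsetI)
      fix z assume "z \<in> cball 0 1 \<inter> ?f -` K"
      then have z: "norm z \<le> 1" "?f z \<in> K" by auto
      with K(2) have "norm (?f z) < 1" by (meson mem_ball_0 subsetD)
      with bdry[of z] z show "z \<in> {z \<in> ball 0 1. ?f z \<in> K}" by fastforce
    qed simp
    moreover have "compact (cball 0 1 \<inter> ?f -` K)"
      unfolding compact_eq_bounded_closed
      using continuous_closed_preimage[OF cont closed_cball compact_imp_closed[OF K(1)]]
      by (simp add: bounded_Int)
    ultimately show "compactin (top_of_set (ball 0 1)) {z \<in> topspace (top_of_set (ball 0 1)). ?f z \<in> K}"
      by (auto simp: compactin_subtopology)
  qed
  then show ?P
    by (simp add: proper_holomorphic_ball_map_def holomorphic_tensor_juxtaposition[OF e])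
qed

end

theory Submission
  imports Defs "HOL-Complex_Analysis.Conformal_Mappings"
begin

text \<open>The automorphisms of the ball are the maps \<open>U \<circ> \<phi>\<^sub>a\<close> with \<open>U\<close> unitary and \<open>\<phi>\<^sub>a\<close> the
  involution exchanging \<open>0\<close> and \<open>a\<close> (\<open>ball_aut_decompose\<close>). This follows from the lemma of Schwarz
  on complex lines, which shows that an automorphism fixing the origin is unitary
  (\<open>ball_aut_fixing_0_unitary\<close>). The explicit form of \<open>\<phi>\<^sub>a\<close> yields the transformation law
  \<open>1 - \<parallel>\<gamma> z\<parallel>\<^sup>2 = (1 - \<parallel>a\<parallel>\<^sup>2) (1 - \<parallel>z\<parallel>\<^sup>2) / \<bar>1 - \<langle>z, a\<rangle>\<bar>\<^sup>2\<close> for an automorphism \<open>\<gamma>\<close> with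
  zero \<open>a\<close> (\<open>ball_aut_norm\<close>).

  Every juxtaposition \<open>f\<close> of tensor powers is equivariant under the unitary group, because
  \<open>A\<close> acts on the target by \<open>\<Oplus>\<^sub>j A\<^sup>\<otimes>\<^sup>m\<^sup>j\<close> (\<open>unitary_group_subset_hermitian_group\<close>). So the
  question is which involutions \<open>\<phi>\<^sub>a\<close> belong to the Hermitian invariant group.

  For the degrees 0 and 1 all of them do. An automorphism of the target turns \<open>f\<close> into a linear isometry,
  and linear isometries intertwine the involutions of source and target
  (\<open>hermitian_group_affine_isometry\<close>).

  If a degree at least two occurs, none with \<open>a \<noteq> 0\<close> does (\<open>hermitian_group_juxtaposition_subset\<close>).
  The relation \<open>f \<circ> \<gamma> = \<psi> \<circ> f\<close> and the transformation laws of \<open>\<gamma>\<close> and \<open>\<psi>\<close> relate the values at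
  \<open>\<parallel>\<gamma> z\<parallel>\<^sup>2\<close> and \<open>\<parallel>z\<parallel>\<^sup>2\<close> of the polynomial \<open>g\<close> given by
  \<open>1 - \<parallel>f z\<parallel>\<^sup>2 = (1 - \<parallel>z\<parallel>\<^sup>2) g(\<parallel>z\<parallel>\<^sup>2)\<close>. On the unit sphere the two values agree, and the maximum
  principle on the complex line of \<open>a\<close> carries this information to the origin, where it reads
  \<open>g(\<parallel>a\<parallel>\<^sup>2) = g(0)\<close>. But \<open>g\<close> has nonnegative coefficients and is not constant.

  In all cases the group contains the unitary group, which is a single full block, and this is the least
  possible source rank (\<open>source_rank_eq_1\<close>).\<close>

section \<open>The Hermitian inner product\<close>

definition herm :: "complex^'n \<Rightarrow> complex^'n \<Rightarrow> complex"
  where "herm z w = (\<Sum>i\<in>UNIV. z $ i * cnj (w $ i))"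

lemma herm_add_left: "herm (x + y) w = herm x w + herm y w"
  and herm_diff_left: "herm (x - y) w = herm x w - herm y w"
  and herm_scale_left: "herm (c *s x) w = c * herm x w"
  and herm_add_right: "herm x (y + w) = herm x y + herm x w"
  and herm_diff_right: "herm x (y - w) = herm x y - herm x w"
  and herm_scale_right: "herm x (c *s w) = cnj c * herm x w"
  and herm_zero_left: "herm 0 w = 0"
  and herm_zero_right: "herm x 0 = 0"
  by (simp_all add: herm_def sum.distrib sum_subtractf sum_distrib_left algebra_simps)

lemmas herm_simps = herm_add_left herm_diff_left herm_scale_left
  herm_add_right herm_diff_right herm_scale_right herm_zero_left herm_zero_right

lemma herm_commute: "herm w z = cnj (herm z w)"
  by (simp add: herm_def mult.commute)

lemma herm_self: "herm z z = complex_of_real ((norm z)\<^sup>2)"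
proof -
  have "(norm z)\<^sup>2 = (\<Sum>i\<in>UNIV. (cmod (z $ i))\<^sup>2)"
    by (simp add: norm_vec_def L2_set_def sum_nonneg)
  then show ?thesis
    by (simp add: herm_def complex_norm_square del: of_real_power)
qed

lemma norm_scale_vec: "norm (c *s z) = cmod c * norm (z :: complex^'n)"
proof -
  have "complex_of_real ((norm (c *s z))\<^sup>2) = herm (c *s z) (c *s z)"
    by (simp only: herm_self)
  also have "\<dots> = (c * cnj c) * herm z z"
    by (simp add: herm_simps)
  also have "\<dots> = complex_of_real ((cmod c * norm z)\<^sup>2)"
    by (simp only: herm_self complex_norm_square[symmetric] power_mult_distrib of_real_mult)
  finally have "(norm (c *s z))\<^sup>2 = (cmod c * norm z)\<^sup>2"
    by (simp only: of_real_eq_iff)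
  then show ?thesis by simp
qed

lemma norm_scale_less:
  fixes v :: "complex^'n"
  assumes "cmod c < 1" "norm v \<le> 1"
  shows "norm (c *s v) < 1"
  using mult_left_le[OF assms(2), of "cmod c"] assms(1) unfolding norm_scale_vec by simp

lemma herm_residual:
  assumes "norm w = 1"
  shows "(norm (z - herm z w *s w))\<^sup>2 = (norm z)\<^sup>2 - (cmod (herm z w))\<^sup>2"
proof -
  have w: "herm w w = 1" using assms by (simp add: herm_self)
  have "complex_of_real ((norm (z - herm z w *s w))\<^sup>2) = herm (z - herm z w *s w) (z - herm z w *s w)"
    by (simp only: herm_self)
  also have "\<dots> = herm z z - herm z w * cnj (herm z w)"
    by (simp add: herm_simps w herm_commute[of w z])
  also have "\<dots> = complex_of_real ((norm z)\<^sup>2 - (cmod (herm z w))\<^sup>2)"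
    by (simp only: herm_self complex_norm_square[symmetric] of_real_diff)
  finally show ?thesis by (simp only: of_real_eq_iff)
qed

lemma cmod_herm_le: "cmod (herm z w) \<le> norm z * norm w"
proof (cases "w = 0")
  case False
  define u where "u = complex_of_real (1 / norm w) *s w"
  have u: "norm u = 1" using False by (simp add: u_def norm_scale_vec norm_divide)
  have "cmod (herm z u) = cmod (herm z w) / norm w"
    unfolding u_def herm_scale_right by (simp add: norm_mult norm_divide)
  moreover have "(cmod (herm z u))\<^sup>2 \<le> (norm z)\<^sup>2"
    using herm_residual[OF u, of z] zero_le_power2[of "norm (z - herm z u *s u)"] by linarith
  then have "cmod (herm z u) \<le> norm z"
    by (rule power2_le_imp_le) simp
  ultimately show ?thesis using False
    by (simp add: pos_divide_le_eq)
qed (simp add: herm_simps)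

text \<open>The equality case of the Cauchy--Schwarz inequality: the residual of the orthogonal projection onto
  \<open>w\<close> has norm zero.\<close>

lemma eq_herm_scale:
  assumes "norm w = 1" "cmod (herm z w) = norm z"
  shows "z = herm z w *s w"
  using herm_residual[OF assms(1), of z] assms(2) by simp

lemma herm_ext:
  assumes "\<And>w. herm x w = herm y w"
  shows "x = y"
proof -
  have "herm (x - y) (x - y) = 0"
    using assms by (simp add: herm_diff_left)
  then show ?thesis by (simp add: herm_self)
qed

text \<open>Polarisation: comparing the norms of \<open>x + y\<close> and of \<open>x + \<i>y\<close> with those of their images
  gives the real and the imaginary part.\<close>

lemma herm_eq_of_norm_eq:
  assumes add: "\<And>x y. T (x + y) = T x + T y" and scale: "\<And>c x. T (c *s x) = c *s T x"
    and norm: "\<And>x. norm (T x) = norm x"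
  shows "herm (T x) (T y) = herm x y"
proof -
  define u v where "u = herm (T x) (T y)" and "v = herm x y"
  have self: "herm (T z) (T z) = herm z z" for z
    by (simp add: herm_self norm)
  have 1: "u + cnj u = v + cnj v"
    using self[of "x + y"] unfolding u_def v_def
    by (simp add: add herm_simps self algebra_simps flip: herm_commute)
  have 2: "\<i> * cnj u - \<i> * u = \<i> * cnj v - \<i> * v"
    using self[of "x + \<i> *s y"] unfolding u_def v_def
    by (simp add: add scale herm_simps self algebra_simps flip: herm_commute)
  have "Re u = Re v" using arg_cong[OF 1, of Re] by simp
  moreover have "Im u = Im v" using arg_cong[OF 2, of Re] by simp
  ultimately show ?thesis unfolding u_def v_def by (simp add: complex_eq_iff)
qed

lemma scaleR_eq_scale: "r *\<^sub>R x = complex_of_real r *s (x :: complex^'n)"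
  unfolding vec_eq_iff vector_scaleR_component vector_smult_component
  by (simp add: scaleR_conv_of_real)

lemma bounded_linear_herm: "bounded_linear (\<lambda>z. herm z w)"
proof (intro linear_conv_bounded_linear[THEN iffD1] linearI)
  show "herm (r *\<^sub>R x) w = r *\<^sub>R herm x w" for r x
    by (simp only: scaleR_eq_scale herm_scale_left) (simp add: scaleR_conv_of_real)
qed (rule herm_add_left)

lemma bounded_linear_scale_fixed: "bounded_linear (\<lambda>\<zeta>. \<zeta> *s (v :: complex^'n))"
proof (intro linear_conv_bounded_linear[THEN iffD1] linearI)
  show "(r *\<^sub>R c) *s v = r *\<^sub>R (c *s v)" for r c
    by (simp only: scaleR_eq_scale) (simp add: vec_eq_iff scaleR_conv_of_real)
qed (simp add: vec_eq_iff algebra_simps)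

lemma bounded_linear_if_complex_linear:
  fixes T :: "complex^'a \<Rightarrow> complex^'b"
  assumes "\<And>x y. T (x + y) = T x + T y" "\<And>c x. T (c *s x) = c *s T x"
  shows "bounded_linear T"
  by (intro linear_conv_bounded_linear[THEN iffD1] linearI) (simp_all add: assms scaleR_eq_scale)

section \<open>Holomorphic maps\<close>

lemma holomorphic_map_on_components:
  fixes f :: "complex^'a \<Rightarrow> complex^'b"
  assumes "\<And>p i. p \<in> S \<Longrightarrow> \<exists>L. ((\<lambda>z. f z $ i) has_derivative L) (at p within S) \<and> (\<forall>c v. L (c *s v) = c * L v)"
  shows "holomorphic_map_on f S"
  unfolding holomorphic_map_on_def
proof
  fix p assume "p \<in> S"
  then have "\<forall>i. \<exists>L. ((\<lambda>z. f z $ i) has_derivative L) (at p within S) \<and> (\<forall>c v. L (c *s v) = c * L v)"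
    using assms by blast
  from choice[OF this] obtain L where L: "\<And>i. ((\<lambda>z. f z $ i) has_derivative L i) (at p within S)"
      "\<And>i c v. L i (c *s v) = c * L i v"
    by blast
  have ax: "bounded_linear (axis a :: complex \<Rightarrow> complex^'b)" for a
    by (intro linear_conv_bounded_linear[THEN iffD1] linearI) (auto simp: axis_def vec_eq_iff)
  have "((\<lambda>z. \<Sum>i\<in>UNIV. axis i (f z $ i)) has_derivative (\<lambda>h. \<Sum>i\<in>UNIV. axis i (L i h))) (at p within S)"
    by (intro has_derivative_sum bounded_linear.has_derivative[OF ax] L(1))
  moreover have "(\<lambda>z. \<Sum>i\<in>UNIV. axis i (f z $ i)) = f"
    by (auto simp: fun_eq_iff vec_eq_iff axis_def)
  moreover have "(\<Sum>i\<in>UNIV. axis i (L i (c *s v))) = c *s (\<Sum>i\<in>UNIV. axis i (L i v))" for c v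
    by (auto simp: vec_eq_iff L(2) axis_def if_distrib cong: if_cong)
  ultimately show "\<exists>L. (f has_derivative L) (at p within S) \<and> (\<forall>c v. L (c *s v) = c *s L v)"
    by (intro exI[of _ "\<lambda>h. \<Sum>i\<in>UNIV. axis i (L i h)"]) simp
qed

lemma holomorphic_map_on_cong:
  assumes "holomorphic_map_on f S" "\<And>z. z \<in> S \<Longrightarrow> g z = f z"
  shows "holomorphic_map_on g S"
  using assms unfolding holomorphic_map_on_def
  by (metis (no_types, lifting) has_derivative_transform)

lemma holomorphic_map_on_compose:
  assumes f: "holomorphic_map_on f S" and g: "holomorphic_map_on g T" and "f ` S \<subseteq> T"
  shows "holomorphic_map_on (\<lambda>z. g (f z)) S"
  unfolding holomorphic_map_on_def
proof
  fix p assume p: "p \<in> S"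
  from f p obtain L where L: "(f has_derivative L) (at p within S)" "\<And>c v. L (c *s v) = c *s L v"
    unfolding holomorphic_map_on_def by blast
  from g p assms(3) obtain M where M: "(g has_derivative M) (at (f p) within T)" "\<And>c v. M (c *s v) = c *s M v"
    unfolding holomorphic_map_on_def by blast
  have "((\<lambda>z. g (f z)) has_derivative (\<lambda>h. M (L h))) (at p within S)"
    using has_derivative_in_compose[OF L(1) has_derivative_subset[OF M(1) assms(3)]] .
  then show "\<exists>K. ((\<lambda>z. g (f z)) has_derivative K) (at p within S) \<and> (\<forall>c v. K (c *s v) = c *s K v)"
    using L(2) M(2) by auto
qed

lemma holomorphic_map_on_linear:
  assumes "\<And>x y. T (x + y) = T x + T y" "\<And>c x. T (c *s x) = c *s T x"
  shows "holomorphic_map_on T S"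
  unfolding holomorphic_map_on_def
  using bounded_linear_imp_has_derivative[OF bounded_linear_if_complex_linear[OF assms]] assms(2)
  by blast

text \<open>Testing a holomorphic map against a fixed vector along a complex line gives a holomorphic
  function of one variable. All the one-variable theorems used below enter through this lemma.\<close>

lemma holomorphic_on_slice:
  fixes f :: "complex^'a \<Rightarrow> complex^'b"
  assumes f: "holomorphic_map_on f (ball 0 1)" and v: "norm v \<le> 1"
  shows "(\<lambda>\<zeta>. herm (f (\<zeta> *s v)) w) holomorphic_on ball 0 1"
proof -
  have sub: "(\<lambda>\<zeta>. \<zeta> *s v) ` ball 0 1 \<subseteq> ball 0 1"
    using norm_scale_less[OF _ v] by auto
  have "\<exists>D. ((\<lambda>\<zeta>. herm (f (\<zeta> *s v)) w) has_field_derivative D) (at x within ball 0 1)"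
    if x: "x \<in> ball 0 1" for x
  proof -
    from f sub x obtain L where L: "(f has_derivative L) (at (x *s v) within ball 0 1)"
        "\<And>c v. L (c *s v) = c *s L v"
      unfolding holomorphic_map_on_def by (meson image_subset_iff)
    have "((\<lambda>\<zeta>. \<zeta> *s v) has_derivative (\<lambda>\<zeta>. \<zeta> *s v)) (at x within ball 0 1)"
      by (rule bounded_linear_imp_has_derivative[OF bounded_linear_scale_fixed])
    from has_derivative_in_compose[OF this has_derivative_subset[OF L(1) sub]]
    have "((\<lambda>\<zeta>. f (\<zeta> *s v)) has_derivative (\<lambda>h. L (h *s v))) (at x within ball 0 1)" .
    from bounded_linear.has_derivative[OF bounded_linear_herm this]
    have "((\<lambda>\<zeta>. herm (f (\<zeta> *s v)) w) has_derivative (\<lambda>h. herm (L (h *s v)) w)) (at x within ball 0 1)" .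
    moreover have "(\<lambda>h. herm (L (h *s v)) w) = (*) (herm (L v) w)"
      by (auto simp: L(2) herm_simps)
    ultimately show ?thesis unfolding has_field_derivative_def by metis
  qed
  then show ?thesis
    by (simp add: holomorphic_on_def field_differentiable_def)
qed

section \<open>Unitary matrices\<close>

lemma herm_matrix: "herm (A *v x) y = herm x (conjugate_transpose A *v y)"
proof -
  have "herm (A *v x) y = (\<Sum>i\<in>UNIV. \<Sum>j\<in>UNIV. A $ i $ j * x $ j * cnj (y $ i))"
    by (simp add: herm_def matrix_vector_mult_def sum_distrib_right)
  also have "\<dots> = (\<Sum>j\<in>UNIV. \<Sum>i\<in>UNIV. A $ i $ j * x $ j * cnj (y $ i))"
    by (rule sum.swap)
  also have "\<dots> = herm x (conjugate_transpose A *v y)"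
    by (simp add: herm_def matrix_vector_mult_def conjugate_transpose_def sum_distrib_left algebra_simps)
  finally show ?thesis .
qed

lemma herm_unitary: "unitary_matrix A \<Longrightarrow> herm (A *v x) (A *v y) = herm x y"
  by (simp add: herm_matrix unitary_matrix_def matrix_vector_mul_assoc)

lemma norm_unitary: 
  assumes "unitary_matrix A" shows "norm (A *v x) = norm x"
proof -
  have "complex_of_real ((norm (A *v x))\<^sup>2) = complex_of_real ((norm x)\<^sup>2)"
    unfolding herm_self[symmetric] by (rule herm_unitary[OF assms])
  then have "(norm (A *v x))\<^sup>2 = (norm x)\<^sup>2" by (simp only: of_real_eq_iff)
  then show ?thesis by simp
qed

lemma matrix_vector_scale: "A *v (c *s x) = c *s (A *v (x :: complex^'n))"
  by (simp add: matrix_vector_mult_def vec_eq_iff sum_distrib_left algebra_simps)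

lemma isometry_eq_unitary_matrix:
  fixes T :: "complex^'n \<Rightarrow> complex^'n"
  assumes add: "\<And>x y. T (x + y) = T x + T y" and scale: "\<And>c x. T (c *s x) = c *s T x"
    and norm: "\<And>x. norm (T x) = norm x"
  obtains A where "unitary_matrix A" "\<And>x. T x = A *v x"
proof -
  define A where "A = (\<chi> i j. T (axis j 1) $ i)"
  have zero: "T 0 = 0" using scale[of 0 0] by simp
  have sumT: "T (sum g F) = (\<Sum>j\<in>F. T (g j))" if "finite F" for g and F :: "'n set"
    using that by induction (auto simp: zero add)
  have TA: "T x = A *v x" for x
  proof -
    have "x = (\<Sum>j\<in>UNIV. x $ j *s axis j 1)"
      by (auto simp: vec_eq_iff axis_def if_distrib cong: if_cong)
    then have "T x = T (\<Sum>j\<in>UNIV. x $ j *s axis j 1)" by simp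
    also have "\<dots> = (\<Sum>j\<in>UNIV. x $ j *s T (axis j 1))"
      by (simp add: sumT scale)
    finally show ?thesis
      by (simp add: vec_eq_iff A_def matrix_vector_mult_def mult.commute)
  qed
  have "conjugate_transpose A *v (A *v x) = x" for x
  proof (rule herm_ext)
    fix w
    have "herm (conjugate_transpose A *v (A *v x)) w = herm (A *v x) (A *v w)"
      by (subst (1 2) herm_commute) (simp only: herm_matrix)
    then show "herm (conjugate_transpose A *v (A *v x)) w = herm x w"
      using herm_eq_of_norm_eq[OF add scale norm, of x w] by (simp add: TA)
  qed
  then have 1: "conjugate_transpose A ** A = mat 1"
    by (simp add: matrix_eq matrix_vector_mul_assoc)
  then have "A ** conjugate_transpose A = mat 1"
    by (rule matrix_left_right_inverse[THEN iffD1])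
  with 1 TA that show ?thesis by (auto simp: unitary_matrix_def)
qed

section \<open>The involutions of the ball\<close>

lemma cmod_herm_less_1:
  assumes "norm z \<le> 1" "norm a < 1"
  shows "cmod (herm z a) < 1"
  using cmod_herm_le[of z a] mult_left_le_one_le[of "norm a" "norm z"] assms by simp

lemma one_minus_herm_nonzero:
  assumes "norm z \<le> 1" "norm a < 1"
  shows "1 - herm z a \<noteq> 0"
  using cmod_herm_less_1[OF assms] by auto

definition defect :: "complex^'n \<Rightarrow> complex"
  where "defect a = complex_of_real (sqrt (1 - (norm a)\<^sup>2))"

text \<open>Let \<open>P\<close> be the orthogonal projection onto the line of \<open>a\<close> and \<open>s = defect a\<close>. The familiar formula
  for the automorphism exchanging \<open>0\<close> and \<open>a\<close> has the numerator \<open>a - P z - s (z - P z)\<close>. Here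
  \<open>P z + s (z - P z) = s z + (1 - s) P z\<close>, and \<open>(1 - s) P z = (\<langle>z, a\<rangle> / (1 + s)) a\<close> because
  \<open>\<parallel>a\<parallel>\<^sup>2 = (1 - s) (1 + s)\<close>. The resulting form avoids the division by \<open>\<parallel>a\<parallel>\<^sup>2\<close>, so that
  \<open>a = 0\<close> is no exception.\<close>

definition ball_involution :: "complex^'n \<Rightarrow> complex^'n \<Rightarrow> complex^'n"
  where "ball_involution a z =
    (\<chi> i. (a $ i - defect a * z $ i - herm z a / (1 + defect a) * a $ i) / (1 - herm z a))"

lemma ball_involution_altdef:
  "ball_involution a z = (1 / (1 - herm z a)) *s
     (a - defect a *s z - (herm z a / (1 + defect a)) *s a)"
  by (simp add: vec_eq_iff ball_involution_def divide_inverse algebra_simps)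

lemma defect_props:
  assumes "norm a < 1"
  shows "defect a * defect a = 1 - herm a a" "cnj (defect a) = defect a"
    "1 + defect a \<noteq> 0" "defect a \<noteq> 0"
proof -
  have *: "(norm a)\<^sup>2 < 1" using assms by (simp add: power_less_one_iff)
  show "defect a * defect a = 1 - herm a a"
    using * by (simp add: defect_def herm_self flip: of_real_mult)
  have "Re (defect a) > 0" using * by (simp add: defect_def)
  then show "1 + defect a \<noteq> 0" "defect a \<noteq> 0" by (auto simp: complex_eq_iff)
qed (simp add: defect_def)

lemma one_minus_herm_ball_involution:
  assumes a: "norm a < 1" and z: "norm z \<le> 1"
  shows "1 - herm (ball_involution a z) a = (1 - herm a a) / (1 - herm z a)"
proof -
  define h s k R where "h = herm z a" and "s = defect a" and "k = 1 / (1 + defect a)" and "R = herm a a"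
  note d = defect_props[OF a]
  have s: "s * s = 1 - R" "k * (1 + s) = 1" using d by (simp_all add: s_def R_def k_def)
  have u: "1 - h \<noteq> 0" using one_minus_herm_nonzero[OF z a] by (simp add: h_def)
  have "herm (ball_involution a z) a = (R - s * h - h * k * R) / (1 - h)"
    unfolding ball_involution_altdef
    by (simp add: herm_simps h_def s_def k_def R_def diff_divide_distrib)
  moreover have "R - s * h - h * k * R = R - h"
    using s by algebra
  ultimately show ?thesis
    using u by (simp add: field_simps flip: h_def R_def)
qed

lemma ball_involution_involution:
  assumes a: "norm a < 1" and z: "norm z \<le> 1"
  shows "ball_involution a (ball_involution a z) = z"
proof -
  define h s k R where "h = herm z a" and "s = defect a" and "k = 1 / (1 + defect a)" and "R = herm a a"
  note d = defect_props[OF a]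
  have s: "s * s = 1 - R" "k * (1 + s) = 1" "s \<noteq> 0" using d by (simp_all add: s_def R_def k_def)
  have u: "1 - h \<noteq> 0" using one_minus_herm_nonzero[OF z a] by (simp add: h_def)
  have R: "1 - R \<noteq> 0" using s by (metis mult_eq_0_iff)
  define w where "w = ball_involution a z"
  have w: "w $ i * (1 - h) = a $ i - s * z $ i - h * k * a $ i" for i
    using u by (simp add: w_def ball_involution_def h_def s_def k_def)
  have wa: "1 - herm w a = (1 - R) / (1 - h)"
    using one_minus_herm_ball_involution[OF a z] by (simp add: w_def h_def R_def)
  then have wa': "herm w a * (1 - h) = R - h"
    using u by (simp add: field_simps)
  have "ball_involution a w $ i = z $ i" for i
  proof -
    have "(a $ i - s * w $ i - herm w a * k * a $ i) * (1 - h)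
        = a $ i * (1 - h) - s * (w $ i * (1 - h)) - (herm w a * (1 - h)) * k * a $ i"
      by (simp add: algebra_simps)
    also have "\<dots> = (1 - R) * z $ i"
      unfolding w wa' using s(1,2) by algebra
    finally have "a $ i - s * w $ i - herm w a * k * a $ i = (1 - R) * z $ i / (1 - h)"
      using u by (simp add: eq_divide_eq)
    then show ?thesis
      using u R by (simp add: ball_involution_def wa flip: s_def) (simp add: k_def s_def)
  qed
  then show ?thesis by (simp add: vec_eq_iff w_def)
qed

text \<open>The transformation law of the defining function \<open>1 - \<parallel>z\<parallel>\<^sup>2\<close> of the ball. After clearing
  denominators it is a polynomial identity in \<open>\<langle>z, a\<rangle>\<close>, its conjugate, \<open>\<parallel>z\<parallel>\<^sup>2\<close> and \<open>s\<close>, modulo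
  \<open>s\<^sup>2 = 1 - \<parallel>a\<parallel>\<^sup>2\<close>.\<close>

lemma norm_ball_involution:
  assumes a: "norm a < 1" and z: "norm z \<le> 1"
  shows "1 - (norm (ball_involution a z))\<^sup>2
    = (1 - (norm a)\<^sup>2) * (1 - (norm z)\<^sup>2) / (cmod (1 - herm z a))\<^sup>2"
proof -
  define h s k R Z where "h = herm z a" and "s = defect a" and "k = 1 / (1 + defect a)"
    and "R = herm a a" and "Z = herm z z"
  note d = defect_props[OF a]
  have s: "s * s = 1 - R" "k * (1 + s) = 1" using d by (simp_all add: s_def R_def k_def)
  have c: "cnj s = s" "cnj k = k" using d by (simp_all add: s_def k_def)
  have u: "1 - h \<noteq> 0" using one_minus_herm_nonzero[OF z a] by (simp add: h_def)
  then have u': "1 - cnj h \<noteq> 0" by (metis complex_cnj_one complex_cnj_diff complex_cnj_zero_iff)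
  define v where "v = a - s *s z - (h * k) *s a"
  have v: "ball_involution a z = (1 / (1 - h)) *s v"
    by (simp add: ball_involution_altdef v_def h_def s_def k_def)
  have az: "herm a z = cnj h" by (simp add: h_def flip: herm_commute)
  have "herm v v = R - s * cnj h - cnj h * k * R - s * (h - s * Z - cnj h * k * h)
      - h * k * (R - s * cnj h - cnj h * k * R)"
    unfolding v_def by (simp add: herm_simps az c algebra_simps flip: h_def R_def Z_def)
  also have "\<dots> = (1 - h) * (1 - cnj h) - (1 - R) * (1 - Z)"
    using s by algebra
  finally have "herm (ball_involution a z) (ball_involution a z)
      = ((1 - h) * (1 - cnj h) - (1 - R) * (1 - Z)) / ((1 - h) * (1 - cnj h))"
    unfolding v by (simp add: herm_simps)
  then have "1 - herm (ball_involution a z) (ball_involution a z)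
      = (1 - R) * (1 - Z) / ((1 - h) * cnj (1 - h))"
    using u u' by (simp add: diff_divide_distrib)
  then have "complex_of_real (1 - (norm (ball_involution a z))\<^sup>2) =
      complex_of_real ((1 - (norm a)\<^sup>2) * (1 - (norm z)\<^sup>2) / (cmod (1 - h))\<^sup>2)"
    unfolding R_def Z_def herm_self complex_norm_square[symmetric] by simp
  then show ?thesis unfolding h_def by (simp only: of_real_eq_iff)
qed

lemma ball_involution_in_ball:
  assumes a: "norm a < 1" and z: "norm z < 1"
  shows "norm (ball_involution a z) < 1"
proof -
  have "1 - herm z a \<noteq> 0" using one_minus_herm_nonzero[of z a] a z by simp
  moreover have "(norm a)\<^sup>2 < 1" "(norm z)\<^sup>2 < 1" using a z by (auto simp: power_less_one_iff)
  ultimately have "1 - (norm (ball_involution a z))\<^sup>2 > 0"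
    using norm_ball_involution[of a z] a z by simp
  then show ?thesis by (simp add: power_less_one_iff)
qed

lemma ball_involution_0: "ball_involution a 0 = a"
  by (simp add: ball_involution_def vec_eq_iff herm_simps)

lemma holomorphic_ball_involution:
  assumes "norm a < 1"
  shows "holomorphic_map_on (ball_involution a) (ball 0 1)"
proof (rule holomorphic_map_on_components)
  fix p i assume "p \<in> ball (0 :: complex^'a) 1"
  then have u: "1 - herm p a \<noteq> 0" using one_minus_herm_nonzero[of p a] assms by simp
  define k where "k = 1 / (1 + defect a)"
  have hd: "((\<lambda>z. herm z a) has_derivative (\<lambda>v. herm v a)) (at p within ball 0 1)"
    by (rule bounded_linear_imp_has_derivative[OF bounded_linear_herm])
  have cd: "((\<lambda>z. z $ i) has_derivative (\<lambda>v. v $ i)) (at p within ball 0 1)"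
    by (rule bounded_linear_imp_has_derivative[OF bounded_linear_vec_nth])
  have n: "((\<lambda>z. a $ i - defect a * z $ i - herm z a * (k * a $ i)) has_derivative
       (\<lambda>v. 0 - defect a * v $ i - herm v a * (k * a $ i))) (at p within ball 0 1)"
    by (intro has_derivative_diff has_derivative_const has_derivative_mult_right
      has_derivative_mult_left hd cd)
  have e: "((\<lambda>z. 1 - herm z a) has_derivative (\<lambda>v. 0 - herm v a)) (at p within ball 0 1)"
    by (intro has_derivative_diff has_derivative_const hd)
  define L where "L v = - (a $ i - defect a * p $ i - herm p a * (k * a $ i)) *
      (inverse (1 - herm p a) * (0 - herm v a) * inverse (1 - herm p a)) +
      (0 - defect a * v $ i - herm v a * (k * a $ i)) / (1 - herm p a)" for v
  have "((\<lambda>z. ball_involution a z $ i) has_derivative L) (at p within ball 0 1)"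
    using has_derivative_divide[OF n e u] by (simp add: ball_involution_def k_def L_def[abs_def])
  moreover have "L (c *s v) = c * L v" for c v
    by (simp add: L_def herm_simps algebra_simps add_divide_distrib diff_divide_distrib)
  ultimately show "\<exists>L. ((\<lambda>z. ball_involution a z $ i) has_derivative L) (at p within ball 0 1) \<and>
      (\<forall>c v. L (c *s v) = c * L v)" by blast
qed

section \<open>The automorphism group\<close>

lemma ball_autI:
  assumes "holomorphic_map_on f (ball 0 1)" "holomorphic_map_on g (ball 0 1)"
    and f: "\<And>z. norm z < 1 \<Longrightarrow> norm (f z) < 1" and g: "\<And>z. norm z < 1 \<Longrightarrow> norm (g z) < 1"
    and gf: "\<And>z. norm z < 1 \<Longrightarrow> g (f z) = z" and fg: "\<And>z. norm z < 1 \<Longrightarrow> f (g z) = z"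
  shows "restrict f (ball 0 1) \<in> ball_aut"
proof -
  let ?f = "restrict f (ball 0 1)"
  have bij: "bij_betw ?f (ball 0 1) (ball 0 1)"
    by (rule bij_betw_byWitness[where f' = g]) (use f g gf fg in auto)
  have "inv_into (ball 0 1) ?f z = g z" if "z \<in> ball 0 1" for z
    using that g fg bij by (intro inv_into_f_eq) (auto simp: bij_betw_def)
  with assms(1,2) have "holomorphic_map_on ?f (ball 0 1)"
      "holomorphic_map_on (inv_into (ball 0 1) ?f) (ball 0 1)"
    by (auto intro: holomorphic_map_on_cong)
  with bij show ?thesis by (simp add: ball_aut_def)
qed

lemma ball_autD:
  assumes "\<gamma> \<in> ball_aut"
  shows "holomorphic_map_on \<gamma> (ball 0 1)" "holomorphic_map_on (inv_into (ball 0 1) \<gamma>) (ball 0 1)"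
    "\<And>z. norm z < 1 \<Longrightarrow> norm (\<gamma> z) < 1" "\<And>z. norm z < 1 \<Longrightarrow> norm (inv_into (ball 0 1) \<gamma> z) < 1"
    "\<And>z. norm z < 1 \<Longrightarrow> inv_into (ball 0 1) \<gamma> (\<gamma> z) = z"
    "\<And>z. norm z < 1 \<Longrightarrow> \<gamma> (inv_into (ball 0 1) \<gamma> z) = z"
    "\<gamma> \<in> extensional (ball 0 1)"
proof -
  let ?d = "inv_into (ball 0 1) \<gamma>"
  have *: "bij_betw \<gamma> (ball 0 1) (ball 0 1)" using assms by (simp add: ball_aut_def)
  show "norm z < 1 \<Longrightarrow> norm (\<gamma> z) < 1" for z using bij_betwE[OF *] by auto
  show "norm z < 1 \<Longrightarrow> norm (?d z) < 1" for z using bij_betwE[OF bij_betw_inv_into[OF *]] by auto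
  show "norm z < 1 \<Longrightarrow> ?d (\<gamma> z) = z" for z using bij_betw_inv_into_left[OF *] by auto
  show "norm z < 1 \<Longrightarrow> \<gamma> (?d z) = z" for z using bij_betw_inv_into_right[OF *] by auto
qed (use assms in \<open>auto simp: ball_aut_def\<close>)

lemma ball_aut_maps_ball: "\<gamma> \<in> ball_aut \<Longrightarrow> norm z < 1 \<Longrightarrow> norm (\<gamma> z) < 1"
  by (rule ball_autD)

lemma ball_aut_compose:
  assumes "\<gamma> \<in> ball_aut" "\<delta> \<in> ball_aut"
  shows "compose (ball 0 1) \<gamma> \<delta> \<in> ball_aut"
proof -
  let ?g = "inv_into (ball 0 1) \<gamma>" and ?d = "inv_into (ball 0 1) \<delta>"
  note g = ball_autD[OF assms(1)] and d = ball_autD[OF assms(2)]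
  show ?thesis unfolding compose_def
  proof (rule ball_autI)
    show "holomorphic_map_on (\<lambda>z. \<gamma> (\<delta> z)) (ball 0 1)"
      by (rule holomorphic_map_on_compose[OF d(1) g(1)]) (use d(3) in auto)
    show "holomorphic_map_on (\<lambda>z. ?d (?g z)) (ball 0 1)"
      by (rule holomorphic_map_on_compose[OF g(2) d(2)]) (use g(4) in auto)
  qed (simp_all add: g d)
qed

lemma ball_involution_aut:
  "norm a < 1 \<Longrightarrow> restrict (ball_involution a) (ball 0 1) \<in> ball_aut"
  by (rule ball_autI[OF holomorphic_ball_involution holomorphic_ball_involution])
    (auto intro: ball_involution_in_ball ball_involution_involution)

lemma unitary_group_subset_ball_aut: "unitary_group \<subseteq> ball_aut"
proof
  fix \<gamma> :: "complex^'n \<Rightarrow> complex^'n" assume "\<gamma> \<in> unitary_group"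
  then obtain A where A: "unitary_matrix A" and \<gamma>: "\<gamma> = linear_ball_map A"
    by (auto simp: unitary_group_def)
  have A': "unitary_matrix (conjugate_transpose A)"
    using A by (auto simp: unitary_matrix_def conjugate_transpose_def)
  show "\<gamma> \<in> ball_aut" unfolding \<gamma> linear_ball_map_def
    by (rule ball_autI[where g = "\<lambda>z. conjugate_transpose A *v z"])
      (use A in \<open>auto intro!: holomorphic_map_on_linear
        simp: matrix_vector_right_distrib matrix_vector_scale norm_unitary[OF A] norm_unitary[OF A']
          matrix_vector_mul_assoc unitary_matrix_def\<close>)
qed

text \<open>The one-variable lemma of Schwarz, applied on the line through \<open>z\<close> to the component in the direction
  of \<open>f z\<close>.\<close>

lemma schwarz_ball:
  assumes f: "holomorphic_map_on f (ball 0 1)" "\<And>z. norm z < 1 \<Longrightarrow> norm (f z) < 1" "f 0 = 0"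
    and z: "norm z < 1"
  shows "norm (f z) \<le> norm z"
proof (cases "z = 0 \<or> f z = 0")
  case False
  define v where "v = complex_of_real (1 / norm z) *s z"
  define w where "w = complex_of_real (1 / norm (f z)) *s f z"
  define F where "F \<zeta> = herm (f (\<zeta> *s v)) w" for \<zeta>
  have v: "norm v = 1" and w: "norm w = 1"
    using False by (simp_all add: v_def w_def norm_scale_vec norm_divide)
  have F: "F holomorphic_on ball 0 1"
    unfolding F_def using holomorphic_on_slice[OF f(1)] v by simp
  have "norm (F \<zeta>) < 1" if "norm \<zeta> < 1" for \<zeta>
  proof -
    have "norm (f (\<zeta> *s v)) < 1" using that v by (intro f norm_scale_less) auto
    then show ?thesis using cmod_herm_le[of "f (\<zeta> *s v)" w] w by (simp add: F_def)
  qed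
  moreover have "F 0 = 0" by (simp add: F_def f herm_simps)
  ultimately have "norm (F (norm z)) \<le> norm (complex_of_real (norm z))"
    using z by (intro Schwarz_Lemma(1)[OF F]) auto
  moreover have "complex_of_real (norm z) *s v = z"
    using False by (simp add: v_def vec_eq_iff)
  then have "F (norm z) = complex_of_real (norm (f z))"
    using False by (simp add: F_def w_def herm_scale_right herm_self power2_eq_square)
  ultimately show ?thesis by simp
qed (use f in auto)

text \<open>The component of \<open>f\<close> in the direction of a single value, taken along the line of \<open>v\<close>, attains
  equality in the lemma of Schwarz at that point, so it is \<open>\<alpha> \<zeta>\<close> with \<open>\<bar>\<alpha>\<bar> = 1\<close>. It then has the
  full norm of \<open>f\<close> everywhere on the line, and the equality case of Cauchy--Schwarz leaves no room
  for the other components.\<close>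

lemma isometric_slice_linear:
  assumes f: "holomorphic_map_on f (ball 0 1)" "\<And>z. norm z < 1 \<Longrightarrow> norm (f z) = norm z"
    and v: "norm v = 1"
  obtains u where "\<And>\<zeta>. norm \<zeta> < 1 \<Longrightarrow> f (\<zeta> *s v) = \<zeta> *s u"
proof -
  \<comment> \<open>The factor 2 normalises: the vector v/2 and its image have norm 1/2.\<close>
  define w where "w = (2 :: complex) *s f ((1/2) *s v)"
  define F where "F \<zeta> = herm (f (\<zeta> *s v)) w" for \<zeta>
  have nf: "norm (f (\<zeta> *s v)) = norm \<zeta>" if "norm \<zeta> < 1" for \<zeta>
    using f(2)[of "\<zeta> *s v"] norm_scale_less[OF that, of v] v by (simp add: norm_scale_vec)
  have nh: "norm (f ((1/2) *s v)) = 1/2" using nf[of "1/2"] by simp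
  then have w: "norm w = 1" by (simp add: w_def norm_scale_vec)
  have F: "F holomorphic_on ball 0 1"
    unfolding F_def using holomorphic_on_slice[OF f(1)] v by simp
  have F1: "norm (F \<zeta>) < 1" if "norm \<zeta> < 1" for \<zeta>
    using cmod_herm_le[of "f (\<zeta> *s v)" w] w nf[OF that] that by (simp add: F_def)
  have "f 0 = 0" using f(2)[of 0] by simp
  then have F0: "F 0 = 0" by (simp add: F_def herm_simps)
  have Fh: "norm (F (1/2)) = norm (1/2 :: complex)"
    by (simp add: F_def w_def herm_simps herm_self nh power2_eq_square)
  have "\<exists>z. norm z < 1 \<and> z \<noteq> 0 \<and> norm (F z) = norm z"
    by (rule exI[of _ "1/2"]) (use Fh in auto)
  then have "\<exists>\<alpha>. (\<forall>z. norm z < 1 \<longrightarrow> F z = \<alpha> * z) \<and> norm \<alpha> = 1"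
    by (intro Schwarz_Lemma(3)[OF F F0 F1, of 0] disjI1) auto
  then obtain \<alpha> where \<alpha>: "\<And>\<zeta>. norm \<zeta> < 1 \<Longrightarrow> F \<zeta> = \<alpha> * \<zeta>" "norm \<alpha> = 1"
    by blast
  show ?thesis
  proof
    fix \<zeta> :: complex assume \<zeta>: "norm \<zeta> < 1"
    have "f (\<zeta> *s v) = F \<zeta> *s w"
      unfolding F_def by (rule eq_herm_scale[OF w]) (use \<alpha> nf \<zeta> in \<open>simp add: norm_mult flip: F_def\<close>)
    then show "f (\<zeta> *s v) = \<zeta> *s (\<alpha> *s w)"
      using \<alpha>(1)[OF \<zeta>] by (simp add: mult.commute)
  qed
qed

text \<open>Cartan's theorem for the ball. The lemma of Schwarz for the map and for its inverse makes the map
  norm-preserving. It is therefore linear on each complex line through \<open>0\<close>, and its derivative at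
  \<open>0\<close> glues these linear maps together.\<close>

lemma ball_aut_fixing_0_unitary:
  assumes "\<gamma> \<in> ball_aut" "\<gamma> 0 = 0"
  shows "\<gamma> \<in> unitary_group"
proof -
  define \<delta> where "\<delta> = inv_into (ball 0 1) \<gamma>"
  note d = ball_autD(1-6)[OF assms(1), folded \<delta>_def] and ext = ball_autD(7)[OF assms(1)]
  have \<delta>0: "\<delta> 0 = 0" using d(5)[of 0] assms(2) by simp
  have nrm: "norm (\<gamma> z) = norm z" if "norm z < 1" for z
  proof (rule antisym)
    show "norm (\<gamma> z) \<le> norm z" by (rule schwarz_ball[OF d(1,3) assms(2) that])
    show "norm z \<le> norm (\<gamma> z)"
      using schwarz_ball[OF d(2,4) \<delta>0 d(3)[OF that]] d(5)[OF that] by simp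
  qed
  have "at 0 within ball (0 :: complex^'a) 1 = at 0" by (rule at_within_open) auto
  then obtain L where L: "(\<gamma> has_derivative L) (at 0)" and Lc: "\<And>c v. L (c *s v) = c *s L v"
    using d(1)[unfolded holomorphic_map_on_def, rule_format, of 0] by auto
  have unit: "\<gamma> (\<zeta> *s v) = \<zeta> *s L v" if v: "norm v = 1" and \<zeta>: "norm \<zeta> < 1" for v \<zeta>
  proof -
    obtain u where u: "\<And>\<zeta>. norm \<zeta> < 1 \<Longrightarrow> \<gamma> (\<zeta> *s v) = \<zeta> *s u"
      using isometric_slice_linear[OF d(1) nrm v] by blast
    have "((\<lambda>\<zeta>. \<zeta> *s v) has_derivative (\<lambda>\<zeta>. \<zeta> *s v)) (at 0)"
      by (rule bounded_linear_imp_has_derivative[OF bounded_linear_scale_fixed])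
    from has_derivative_compose[OF this, of \<gamma> L] L
    have 1: "((\<lambda>\<zeta>. \<gamma> (\<zeta> *s v)) has_derivative (\<lambda>h. L (h *s v))) (at 0)" by simp
    have "((\<lambda>\<zeta>. \<zeta> *s u) has_derivative (\<lambda>\<zeta>. \<zeta> *s u)) (at 0)"
      by (rule bounded_linear_imp_has_derivative[OF bounded_linear_scale_fixed])
    then have 2: "((\<lambda>\<zeta>. \<gamma> (\<zeta> *s v)) has_derivative (\<lambda>h. h *s u)) (at 0)"
      by (rule has_derivative_transform_within_open[where s = "ball 0 1"]) (use u in auto)
    have "L v = u" using has_derivative_unique[OF 1 2, THEN fun_cong, of 1] by simp
    with u \<zeta> show ?thesis by simp
  qed
  have \<gamma>L: "\<gamma> z = L z" if z: "norm z < 1" for z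
  proof (cases "z = 0")
    case False
    define v where "v = complex_of_real (1 / norm z) *s z"
    have v: "norm v = 1" using False by (simp add: v_def norm_scale_vec norm_divide)
    have zv: "z = complex_of_real (norm z) *s v" using False by (simp add: v_def vec_eq_iff)
    have "\<gamma> (complex_of_real (norm z) *s v) = complex_of_real (norm z) *s L v"
      by (rule unit) (use v z in auto)
    then show ?thesis using zv Lc by metis
  qed (use Lc[of 0 0] assms(2) in simp)
  have Ladd: "L (x + y) = L x + L y" for x y
    using has_derivative_linear[OF L] by (rule linear_add)
  have Lnorm: "norm (L x) = norm x" for x
  proof -
    \<comment> \<open>Any factor that moves x into the ball would do.\<close>
    define r where "r = complex_of_real (1 / (norm x + 1))"
    have r: "cmod r = 1 / (norm x + 1)" 
      by (simp only: r_def norm_of_real) (simp add: add_nonneg_pos)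
    then have "norm (r *s x) < 1" by (simp add: norm_scale_vec divide_less_eq add_nonneg_pos)
    then have "norm (L (r *s x)) = norm (r *s x)" using \<gamma>L nrm by metis
    moreover have "cmod r \<noteq> 0" using r norm_ge_zero[of x] by (simp add: add_nonneg_eq_0_iff)
    ultimately show ?thesis by (simp add: Lc norm_scale_vec)
  qed
  obtain A where A: "unitary_matrix A" "\<And>x. L x = A *v x"
    using isometry_eq_unitary_matrix[OF Ladd Lc Lnorm] by blast
  have "\<gamma> = linear_ball_map A"
    unfolding linear_ball_map_def
    by (rule extensionalityI[OF ext]) (auto simp: \<gamma>L A)
  with A(1) show ?thesis by (auto simp: unitary_group_def)
qed

text \<open>Composing with the involution that takes \<open>0\<close> to the zero \<open>a\<close> of \<open>\<gamma>\<close> reduces to the case of a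
  fixed origin.\<close>

lemma ball_aut_decompose:
  assumes "\<gamma> \<in> ball_aut"
  obtains a A where "norm a < 1" "\<gamma> a = 0" "unitary_matrix A"
    "\<And>z. norm z < 1 \<Longrightarrow> \<gamma> z = A *v ball_involution a z"
proof -
  define a where "a = inv_into (ball 0 1) \<gamma> 0"
  have a: "norm a < 1" "\<gamma> a = 0" using ball_autD(4,6)[OF assms, of 0] by (auto simp: a_def)
  have "compose (ball 0 1) \<gamma> (restrict (ball_involution a) (ball 0 1)) \<in> unitary_group"
    by (rule ball_aut_fixing_0_unitary[OF ball_aut_compose[OF assms ball_involution_aut[OF a(1)]]])
      (simp add: compose_def ball_involution_0 a)
  then obtain A where A: "unitary_matrix A"
    "compose (ball 0 1) \<gamma> (restrict (ball_involution a) (ball 0 1)) = linear_ball_map A"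
    by (auto simp: unitary_group_def)
  have "\<gamma> z = A *v ball_involution a z" if "norm z < 1" for z
    using fun_cong[OF A(2), of "ball_involution a z"] ball_involution_in_ball[OF a(1) that]
      ball_involution_involution[OF a(1), of z] that
    by (simp add: compose_def linear_ball_map_def)
  with a A(1) that show ?thesis by blast
qed

lemma ball_aut_norm:
  assumes "\<gamma> \<in> ball_aut"
  obtains a where "norm a < 1" "\<gamma> a = 0" 
    "\<And>z. norm z < 1 \<Longrightarrow> 1 - (norm (\<gamma> z))\<^sup>2
      = (1 - (norm a)\<^sup>2) * (1 - (norm z)\<^sup>2) / (cmod (1 - herm z a))\<^sup>2"
  using ball_aut_decompose[OF assms] norm_ball_involution norm_unitary
  by (metis less_imp_le)

section \<open>Unitary maps act on tensor powers\<close>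

lemma sum_words_prod_nth:
  fixes g :: "nat \<Rightarrow> 'n::finite \<Rightarrow> complex"
  shows "(\<Sum>w\<in>words d. \<Prod>i<d. g i (w ! i)) = (\<Prod>i<d. \<Sum>l\<in>UNIV. g i l)"
proof (induction d arbitrary: g)
  case 0
  then show ?case by (simp add: words_def)
next
  case (Suc d)
  have "words (Suc d) = (\<lambda>(l, w). l # w) ` (UNIV \<times> (words d :: 'n list set))"
    by (auto simp: words_def length_Suc_conv image_iff)
  moreover have "inj_on (\<lambda>(l, w). l # w) (UNIV \<times> (words d :: 'n list set))"
    by (auto simp: inj_on_def)
  ultimately have "(\<Sum>w\<in>words (Suc d). \<Prod>i<Suc d. g i (w ! i)) =
      (\<Sum>(l, w)\<in>UNIV \<times> words d. g 0 l * (\<Prod>i<d. g (Suc i) (w ! i)))"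
    by (simp only: sum.reindex) (simp add: case_prod_beta prod.lessThan_Suc_shift del: prod.lessThan_Suc)
  also have "\<dots> = (\<Sum>l\<in>UNIV. g 0 l) * (\<Sum>w\<in>words d. \<Prod>i<d. g (Suc i) (w ! i))"
    by (simp add: sum_product sum.cartesian_product)
  also have "\<dots> = (\<Prod>i<Suc d. \<Sum>l\<in>UNIV. g i l)"
    by (simp add: Suc[of "\<lambda>i. g (Suc i)"] prod.lessThan_Suc_shift del: prod.lessThan_Suc)
  finally show ?case .
qed

lemma tensor_power_nth: "w \<in> words d \<Longrightarrow> tensor_power d z w = (\<Prod>i<d. z $ (w ! i))"
  by (simp add: tensor_power_def words_def prod.list_conv_set_nth lessThan_atLeast0)

lemma finite_juxtaposition_index: "finite (juxtaposition_index k m :: (nat \<times> 'n::finite list) set)"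
  by (simp add: juxtaposition_index_def finite_words)

text \<open>The matrix of \<open>\<Oplus>\<^sub>j A\<^sup>\<otimes>\<^sup>m\<^sup>j\<close> in the basis of words.\<close>

definition tensor_sum_entry ::
    "(nat \<Rightarrow> nat) \<Rightarrow> complex^'n^'n \<Rightarrow> nat \<times> 'n list \<Rightarrow> nat \<times> 'n list \<Rightarrow> complex"
  where "tensor_sum_entry m A p q =
    (if fst p = fst q then \<Prod>i<m (fst p). A $ (snd p ! i) $ (snd q ! i) else 0)"

definition tensor_sum_matrix ::
    "nat \<Rightarrow> (nat \<Rightarrow> nat) \<Rightarrow> (nat \<times> 'n list \<Rightarrow> 'N) \<Rightarrow> complex^'n^'n \<Rightarrow> complex^'N^'N"
  where "tensor_sum_matrix k m e A = (\<chi> x y. tensor_sum_entry m A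
    (inv_into (juxtaposition_index k m) e x) (inv_into (juxtaposition_index k m) e y))"

text \<open>The matrices are block diagonal: in a sum over all indices only one summand of the orthogonal sum
  survives.\<close>

lemma sum_juxtaposition_index_block:
  fixes G :: "nat \<times> 'n::finite list \<Rightarrow> complex"
  assumes "j < k" "\<And>p. fst p \<noteq> j \<Longrightarrow> G p = 0"
  shows "(\<Sum>p\<in>juxtaposition_index k m. G p) = (\<Sum>w\<in>words (m j). G (j, w))"
proof -
  have "(\<Sum>p\<in>juxtaposition_index k m. G p) = (\<Sum>p\<in>Pair j ` words (m j). G p)"
    using assms(1)
    by (intro sum.mono_neutral_right finite_juxtaposition_index)
      (auto simp: juxtaposition_index_def image_iff intro!: assms(2))
  also have "\<dots> = (\<Sum>w\<in>words (m j). G (j, w))"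
    by (simp add: sum.reindex inj_on_def)
  finally show ?thesis .
qed

lemma tensor_sum_entry_mult:
  fixes A B :: "complex^'n^'n"
  assumes p: "p \<in> juxtaposition_index k m"
  shows "(\<Sum>r\<in>juxtaposition_index k m. tensor_sum_entry m A p r * tensor_sum_entry m B r q)
    = tensor_sum_entry m (A ** B) p q"
proof (cases "fst p = fst q")
  case False
  then show ?thesis by (auto simp: tensor_sum_entry_def intro!: sum.neutral)
next
  case True
  obtain j w where jw: "p = (j, w)" by (cases p)
  then have j: "j < k" using p by (auto simp: juxtaposition_index_def)
  have "(\<Sum>r\<in>juxtaposition_index k m. tensor_sum_entry m A p r * tensor_sum_entry m B r q)
    = (\<Sum>v\<in>words (m j). \<Prod>i<m j. A $ (w ! i) $ (v ! i) * B $ (v ! i) $ (snd q ! i))"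
    using True
    by (subst sum_juxtaposition_index_block[OF j]) (auto simp: tensor_sum_entry_def jw prod.distrib)
  also have "\<dots> = (\<Prod>i<m j. \<Sum>l\<in>UNIV. A $ (w ! i) $ l * B $ l $ (snd q ! i))"
    by (rule sum_words_prod_nth)
  also have "\<dots> = tensor_sum_entry m (A ** B) p q"
    using True by (simp add: tensor_sum_entry_def jw matrix_matrix_mult_def)
  finally show ?thesis .
qed

lemma tensor_sum_entry_one:
  assumes "p \<in> juxtaposition_index k m" "q \<in> juxtaposition_index k m"
  shows "tensor_sum_entry m (mat 1) p q = (if p = q then 1 else 0)"
proof (cases "p = q")
  case False
  have "\<exists>i<m (fst p). snd p ! i \<noteq> snd q ! i" if "fst p = fst q"
  proof (rule ccontr)
    assume "\<not> ?thesis"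
    with assms that have "snd p = snd q"
      by (intro nth_equalityI) (auto simp: juxtaposition_index_def words_def)
    with that False show False by (simp add: prod_eq_iff)
  qed
  with False show ?thesis by (auto simp: tensor_sum_entry_def mat_def)
qed (simp add: tensor_sum_entry_def mat_def)

lemma tensor_sum_entry_adjoint:
  "tensor_sum_entry m (conjugate_transpose A) p q = cnj (tensor_sum_entry m A q p)"
  by (simp add: tensor_sum_entry_def conjugate_transpose_def)

lemma tensor_sum_entry_apply:
  fixes A :: "complex^'n^'n"
  assumes p: "p \<in> juxtaposition_index k m"
  shows "(\<Sum>r\<in>juxtaposition_index k m. tensor_sum_entry m A p r *
      juxtaposition lam (\<lambda>j. tensor_power (m j)) z r)
    = juxtaposition lam (\<lambda>j. tensor_power (m j)) (A *v z) p"
proof -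
  obtain j w where jw: "p = (j, w)" by (cases p)
  then have j: "j < k" and w: "w \<in> words (m j)" using p by (auto simp: juxtaposition_index_def)
  have "(\<Sum>r\<in>juxtaposition_index k m. tensor_sum_entry m A p r *
      juxtaposition lam (\<lambda>j. tensor_power (m j)) z r)
    = (\<Sum>v\<in>words (m j). lam j * (\<Prod>i<m j. A $ (w ! i) $ (v ! i) * z $ (v ! i)))"
    by (subst sum_juxtaposition_index_block[OF j])
      (auto simp: tensor_sum_entry_def jw prod.distrib juxtaposition_def tensor_power_nth
        mult.left_commute)
  also have "\<dots> = lam j * (\<Prod>i<m j. \<Sum>l\<in>UNIV. A $ (w ! i) $ l * z $ l)"
    by (simp only: sum_distrib_left[symmetric]
        sum_words_prod_nth[of "\<lambda>i l. A $ (w ! i) $ l * z $ l" "m j"])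
  finally show ?thesis
    using w by (simp add: jw juxtaposition_def tensor_power_nth matrix_vector_mult_def)
qed

context
  fixes k :: nat and m :: "nat \<Rightarrow> nat" and e :: "nat \<times> 'n::finite list \<Rightarrow> 'N::finite"
  assumes e: "bij_betw e (juxtaposition_index k m) UNIV"
begin

private lemma index_bij:
  "bij_betw (inv_into (juxtaposition_index k m) e) UNIV (juxtaposition_index k m)"
  by (rule bij_betw_inv_into[OF e])

private lemma index_mem: "inv_into (juxtaposition_index k m) e x \<in> juxtaposition_index k m"
  using bij_betwE[OF index_bij] by blast

lemma tensor_sum_matrix_mult:
  "tensor_sum_matrix k m e A ** tensor_sum_matrix k m e B = tensor_sum_matrix k m e (A ** B)"
proof -
  have "(\<Sum>y\<in>UNIV. tensor_sum_matrix k m e A $ x $ y * tensor_sum_matrix k m e B $ y $ x')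
    = tensor_sum_matrix k m e (A ** B) $ x $ x'" for x x'
    unfolding tensor_sum_matrix_def vec_lambda_beta
    by (subst sum.reindex_bij_betw[OF index_bij, of "\<lambda>r. tensor_sum_entry m A
          (inv_into (juxtaposition_index k m) e x) r *
          tensor_sum_entry m B r (inv_into (juxtaposition_index k m) e x')"])
      (rule tensor_sum_entry_mult[OF index_mem])
  then show ?thesis by (simp add: vec_eq_iff matrix_matrix_mult_def)
qed

lemma tensor_sum_matrix_one: "tensor_sum_matrix k m e (mat 1) = mat 1"
proof -
  have "inv_into (juxtaposition_index k m) e x = inv_into (juxtaposition_index k m) e y \<longleftrightarrow> x = y" for x y
    using index_bij by (auto simp: bij_betw_def inj_on_def)
  then show ?thesis
    by (simp add: vec_eq_iff tensor_sum_matrix_def tensor_sum_entry_one[OF index_mem index_mem])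
      (simp add: mat_def)
qed

lemma unitary_tensor_sum_matrix:
  assumes "unitary_matrix A"
  shows "unitary_matrix (tensor_sum_matrix k m e A)"
proof -
  have "conjugate_transpose (tensor_sum_matrix k m e A)
      = tensor_sum_matrix k m e (conjugate_transpose A)"
    by (simp add: vec_eq_iff tensor_sum_matrix_def tensor_sum_entry_adjoint)
      (simp add: conjugate_transpose_def)
  with assms show ?thesis
    by (simp add: unitary_matrix_def tensor_sum_matrix_mult tensor_sum_matrix_one)
qed

lemma tensor_juxtaposition_equivariant:
  "tensor_juxtaposition k lam m e (A *v z)
    = tensor_sum_matrix k m e A *v tensor_juxtaposition k lam m e z"
proof -
  have "(\<Sum>y\<in>UNIV. tensor_sum_matrix k m e A $ x $ y * tensor_juxtaposition k lam m e z $ y)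
    = tensor_juxtaposition k lam m e (A *v z) $ x" for x
    unfolding tensor_sum_matrix_def tensor_juxtaposition_def enumerate_coords_def vec_lambda_beta
    by (subst sum.reindex_bij_betw[OF index_bij, of "\<lambda>r. tensor_sum_entry m A
          (inv_into (juxtaposition_index k m) e x) r *
          juxtaposition lam (\<lambda>j. tensor_power (m j)) z r"])
      (rule tensor_sum_entry_apply[OF index_mem])
  then show ?thesis by (simp add: vec_eq_iff matrix_vector_mult_def)
qed

text \<open>The unitary matrix \<open>A\<close> of the source is matched by the unitary matrix \<open>\<Oplus>\<^sub>j A\<^sup>\<otimes>\<^sup>m\<^sup>j\<close>
  of the target.\<close>

lemma unitary_group_subset_hermitian_group:
  assumes "\<And>z. norm z < 1 \<Longrightarrow> norm (tensor_juxtaposition k lam m e z) < 1"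
  shows "unitary_group \<subseteq> hermitian_group (tensor_juxtaposition k lam m e)"
proof
  fix \<gamma> :: "complex^'n \<Rightarrow> complex^'n" assume g: "\<gamma> \<in> unitary_group"
  then obtain A where A: "unitary_matrix A" and \<gamma>: "\<gamma> = linear_ball_map A"
    by (auto simp: unitary_group_def)
  have "linear_ball_map (tensor_sum_matrix k m e A) \<in> ball_aut"
    using unitary_tensor_sum_matrix[OF A] unitary_group_subset_ball_aut
    by (auto simp: unitary_group_def)
  moreover have "\<gamma> \<in> ball_aut" using g unitary_group_subset_ball_aut by auto
  moreover have "tensor_juxtaposition k lam m e (\<gamma> z) =
      linear_ball_map (tensor_sum_matrix k m e A) (tensor_juxtaposition k lam m e z)"
    if "z \<in> ball 0 1" for z
    using that assms[of z] by (simp add: \<gamma> linear_ball_map_def tensor_juxtaposition_equivariant)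
  ultimately show "\<gamma> \<in> hermitian_group (tensor_juxtaposition k lam m e)"
    by (auto simp: hermitian_group_def)
qed

lemma continuous_on_tensor_juxtaposition: "continuous_on S (tensor_juxtaposition k lam m e)"
  using holomorphic_tensor_juxtaposition[OF e, of lam S]
  unfolding holomorphic_map_on_def continuous_on_eq_continuous_within
  by (metis has_derivative_continuous)

end

section \<open>Hermitian invariant groups\<close>

lemma tensor_juxtaposition_maps_ball:
  fixes e :: "nat \<times> 'n::finite list \<Rightarrow> 'N::finite"
  assumes "proper_holomorphic_ball_map (tensor_juxtaposition k lam m e)" "norm z < 1"
  shows "norm (tensor_juxtaposition k lam m e z) < 1"
  using proper_map_imp_subset_topspace[of "top_of_set (ball 0 1)" "top_of_set (ball 0 1)"
      "tensor_juxtaposition k lam m e"] assms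
  by (fastforce simp: proper_holomorphic_ball_map_def)

lemma hermitian_group_compose:
  assumes f: "\<And>z. norm z < 1 \<Longrightarrow> norm (f z) < 1"
    and "\<gamma> \<in> hermitian_group f" "\<delta> \<in> hermitian_group f"
  shows "compose (ball 0 1) \<gamma> \<delta> \<in> hermitian_group f"
proof -
  from assms obtain \<psi> \<eta> where *: "\<gamma> \<in> ball_aut" "\<delta> \<in> ball_aut" "\<psi> \<in> ball_aut" "\<eta> \<in> ball_aut"
    "\<And>z. norm z < 1 \<Longrightarrow> f (\<gamma> z) = \<psi> (f z)" "\<And>z. norm z < 1 \<Longrightarrow> f (\<delta> z) = \<eta> (f z)"
    by (auto simp: hermitian_group_def)
  have "f (compose (ball 0 1) \<gamma> \<delta> z) = compose (ball 0 1) \<psi> \<eta> (f z)" if "z \<in> ball 0 1" for z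
    using that by (simp add: compose_def * f ball_aut_maps_ball[OF *(2)])
  with ball_aut_compose[OF *(1,2)] ball_aut_compose[OF *(3,4)] show ?thesis
    by (auto simp: hermitian_group_def intro!: bexI[of _ "compose (ball 0 1) \<psi> \<eta>"])
qed

section \<open>Affine isometric embeddings\<close>

lemma hermitian_group_identity: "hermitian_group (\<lambda>z. z) = ball_aut"
  by (auto simp: hermitian_group_def)

text \<open>The involution is expressed through inner products and linear combinations only, so linear
  isometries intertwine the involutions of the two balls.\<close>

lemma ball_involution_isometry:
  fixes T :: "complex^'a \<Rightarrow> complex^'b"
  assumes add: "\<And>x y. T (x + y) = T x + T y" and scale: "\<And>c x. T (c *s x) = c *s T x"
    and norm: "\<And>x. norm (T x) = norm x"
  shows "ball_involution (T a) (T z) = T (ball_involution a z)"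
proof -
  have diff: "T (x - y) = T x - T y" for x y
  proof -
    have "T (x + (-1) *s y) = T x + (-1) *s T y" by (simp only: add scale)
    then show ?thesis by simp
  qed
  have "defect (T a) = defect a" by (simp add: defect_def norm)
  then show ?thesis
    by (simp add: ball_involution_altdef herm_eq_of_norm_eq[OF add scale norm] diff scale)
qed

text \<open>Only the involutions need a matching automorphism of the target. The image of \<open>f\<close> lies in the
  affine slice of the target ball through \<open>b = f 0\<close> that is orthogonal to \<open>b\<close>. The involution at \<open>b\<close> moves this slice to a linear one and turns \<open>f\<close> into a linear isometry
  \<open>T'\<close>. For \<open>T'\<close> the involution at \<open>a\<close> is matched by the one at \<open>T' a\<close>; conjugating back
  by the involution at \<open>b\<close> gives the required automorphism for \<open>f\<close>.\<close>

lemma hermitian_group_affine_isometry: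
  fixes T :: "complex^'a \<Rightarrow> complex^'b"
  assumes add: "\<And>x y. T (x + y) = T x + T y" and scale: "\<And>c x. T (c *s x) = c *s T x"
    and norm: "\<And>x. norm (T x) = norm x"
    and orth: "\<And>x. herm (T x) b = 0"
    and f: "\<And>z. f z = b + c *s T z" and c: "(norm b)\<^sup>2 + (cmod c)\<^sup>2 = 1" "c \<noteq> 0"
    and ball: "\<And>z. norm z < 1 \<Longrightarrow> norm (f z) < 1"
    and unitary: "unitary_group \<subseteq> hermitian_group f"
  shows "hermitian_group f = ball_aut"
proof
  show "ball_aut \<subseteq> hermitian_group f"
  proof
    fix \<gamma> :: "complex^'a \<Rightarrow> complex^'a" assume g: "\<gamma> \<in> ball_aut"
    obtain a A where a: "norm a < 1" and A: "unitary_matrix A"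
      and \<gamma>: "\<And>z. norm z < 1 \<Longrightarrow> \<gamma> z = A *v ball_involution a z"
      using ball_aut_decompose[OF g] by metis
    let ?\<phi> = "\<lambda>a. restrict (ball_involution a) (ball 0 1)"
    have "(norm b)\<^sup>2 < 1" using c by (smt (verit) norm_eq_zero zero_less_power2)
    then have b: "norm b < 1" by (simp add: power_less_one_iff)
    define s where "s = defect b"
    have s: "s = cmod c" using c(1) by (simp add: s_def defect_def flip: c(1))
    note d = defect_props[OF b, folded s_def]
    \<comment> \<open>The factor has modulus 1 since s is the modulus of c.\<close>
    define T' where "T' z = (- (c / s)) *s T z" for z
    have T': "T' (x + y) = T' x + T' y" "T' (r *s x) = r *s T' x" "norm (T' x) = norm x" for x y r
      using c(2) by (simp_all add: T'_def add scale norm norm_scale_vec vec_eq_iff algebra_simps norm_divide s)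
    have b1: "ball_involution b (f z) = T' z" for z
    proof -
      have h: "herm (f z) b = herm b b" by (simp add: f herm_simps orth)
      have R: "herm b b = 1 - s * s" using d(1) by simp
      have "(b $ i - s * (b $ i + c * T z $ i) - herm b b / (1 + s) * b $ i) / (1 - herm b b) = - (c / s) * T z $ i" for i
      proof -
        have K: "herm b b / (1 + s) = 1 - s"
          using d(3) unfolding R by (subst nonzero_divide_eq_eq) (auto simp: algebra_simps)
        show ?thesis
          using d(4) unfolding K unfolding R by (simp add: divide_simps algebra_simps)
      qed
      then show ?thesis
        by (simp only: vec_eq_iff ball_involution_def h flip: s_def) (simp add: f T'_def)
    qed
    have b2: "ball_involution b (T' z) = f z" if "norm z < 1" for z
      using ball_involution_involution[OF b, of "f z"] ball[OF that] by (simp add: b1)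
    have "?\<phi> a \<in> hermitian_group f"
    proof -
      have T'a: "norm (T' a) < 1" using a by (simp add: T')
      let ?\<psi> = "compose (ball 0 1) (?\<phi> b) (compose (ball 0 1) (?\<phi> (T' a)) (?\<phi> b))"
      have "f (?\<phi> a z) = ?\<psi> (f z)" if "z \<in> ball 0 1" for z
      proof -
        have z: "norm z < 1" using that by simp
        note z' = ball_involution_in_ball[OF a z]
        show ?thesis
          using z ball[OF z] z' by (simp add: compose_def b1 b2 T'(3) ball_involution_isometry[OF T'])
      qed
      then show ?thesis
        using ball_aut_compose[OF ball_involution_aut[OF b] ball_aut_compose[OF ball_involution_aut[OF T'a] ball_involution_aut[OF b]]]
          ball_involution_aut[OF a]
        by (auto simp: hermitian_group_def)
    qed
    moreover have "linear_ball_map A \<in> hermitian_group f"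
      using A unitary by (auto simp: unitary_group_def)
    ultimately have "compose (ball 0 1) (linear_ball_map A) (?\<phi> a) \<in> hermitian_group f"
      by (intro hermitian_group_compose ball)
    moreover have "\<gamma> = compose (ball 0 1) (linear_ball_map A) (?\<phi> a)"
      by (rule extensionalityI[OF ball_autD(7)[OF g]])
        (auto simp: compose_def linear_ball_map_def \<gamma> ball_involution_in_ball[OF a])
    ultimately show "\<gamma> \<in> hermitian_group f" by simp
  qed
qed (auto simp: hermitian_group_def)

text \<open>The constant summand is the base point \<open>b\<close> and the linear summand is a multiple of an isometry
  orthogonal to it. Both are themselves juxtapositions with at most one nonzero coefficient, so their norms
  come from the general norm formula.\<close>

lemma hermitian_group_juxtaposition_0_1:
  fixes e :: "nat \<times> 'n::finite list \<Rightarrow> 'N::finite"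
  assumes lam: "(\<Sum>j<k. (cmod (lam j))\<^sup>2) = 1"
    and e: "bij_betw e (juxtaposition_index k m) UNIV"
    and proper: "proper_holomorphic_ball_map (tensor_juxtaposition k lam m e)"
    and k: "k = 2" "m 0 = 0" "m 1 = 1"
  shows "hermitian_group (tensor_juxtaposition k lam m e) = ball_aut"
proof -
  let ?W = "inv_into (juxtaposition_index k m) e"
  have two: "{..<2::nat} = {0, 1}" by auto
  have mem: "?W x \<in> juxtaposition_index k m" for x
    using bij_betwE[OF bij_betw_inv_into[OF e]] by blast
  have W: "fst (?W x) = 0 \<and> snd (?W x) = [] \<or> fst (?W x) = 1 \<and> (\<exists>i. snd (?W x) = [i])" for x
    using mem[of x] k by (auto simp: juxtaposition_index_def words_def two length_Suc_conv)
  define T where "T = tensor_juxtaposition k (\<lambda>j. if j = 1 then 1 else 0) m e"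
  define b where "b = tensor_juxtaposition k (\<lambda>j. if j = 0 then lam 0 else 0) m e 0"
  have T_nth: "T z $ x = (if fst (?W x) = 0 then 0 else z $ hd (snd (?W x)))" for z x
    using W[of x] k unfolding T_def tensor_juxtaposition_def enumerate_coords_def juxtaposition_def
    by (auto simp: case_prod_beta tensor_power_def words_def)
  have b_nth: "b $ x = (if fst (?W x) = 0 then lam 0 else 0)" for x
    using W[of x] k unfolding b_def tensor_juxtaposition_def enumerate_coords_def juxtaposition_def
    by (auto simp: case_prod_beta tensor_power_def words_def)
  show ?thesis
  proof (rule hermitian_group_affine_isometry[of T b _ "lam 1"])
    show "T (x + y) = T x + T y" "T (c *s x) = c *s T x" for x y c
      by (simp_all add: vec_eq_iff T_nth)
    show "norm (T z) = norm z" for z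
    proof -
      have "(norm (T z))\<^sup>2 = (norm z)\<^sup>2"
        unfolding T_def norm_tensor_juxtaposition[OF e] unfolding k(1) two using k by simp
      then show ?thesis by simp
    qed
    show "herm (T z) b = 0" for z
      by (auto simp: herm_def T_nth b_nth intro!: sum.neutral)
    have "(norm b)\<^sup>2 = (cmod (lam 0))\<^sup>2"
      unfolding b_def norm_tensor_juxtaposition[OF e] unfolding k(1) two using k by simp
    then show "(norm b)\<^sup>2 + (cmod (lam 1))\<^sup>2 = 1"
      using lam unfolding k(1) two by simp
    have "\<exists>j<k. lam j \<noteq> 0 \<and> 0 < m j"
      using proper proper_tensor_juxtaposition_iff[OF lam e] by simp
    then show "lam 1 \<noteq> 0" using k by (auto simp: less_2_cases_iff)
    show "tensor_juxtaposition k lam m e z = b + lam 1 *s T z" for z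
    proof (simp only: vec_eq_iff, rule allI)
      fix x
      show "tensor_juxtaposition k lam m e z $ x = (b + lam 1 *s T z) $ x"
        using W[of x] k
        by (auto simp: T_nth b_nth tensor_juxtaposition_def enumerate_coords_def juxtaposition_def
            case_prod_beta tensor_power_def words_def)
    qed
    show "norm (tensor_juxtaposition k lam m e z) < 1" if "norm z < 1" for z
      by (rule tensor_juxtaposition_maps_ball[OF proper that])
    show "unitary_group \<subseteq> hermitian_group (tensor_juxtaposition k lam m e)"
      by (rule unitary_group_subset_hermitian_group[OF e tensor_juxtaposition_maps_ball[OF proper]])
  qed
qed

section \<open>Rigidity in degree at least two\<close>

text \<open>The maximum principle for \<open>h\<close> and for \<open>1 / h\<close>.\<close>

lemma cmod_constant_on_circle:
  assumes hol: "h holomorphic_on ball 0 1" and cont: "continuous_on (cball 0 1) h"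
    and nz: "\<And>\<zeta>. norm \<zeta> \<le> 1 \<Longrightarrow> h \<zeta> \<noteq> 0"
    and circle: "\<And>\<zeta>. norm \<zeta> = 1 \<Longrightarrow> norm (h \<zeta>) = c"
  shows "norm (h 0) = c"
proof (rule antisym)
  show "norm (h 0) \<le> c"
    by (rule maximum_modulus_frontier[where S = "ball 0 1"]) (use assms in auto)
  have c: "c > 0" using circle[of 1] nz[of 1] by auto
  have "norm (1 / h 0) \<le> 1 / c"
    by (rule maximum_modulus_frontier[where S = "ball 0 1" and f = "\<lambda>\<zeta>. 1 / h \<zeta>"])
      (use assms in \<open>auto intro!: holomorphic_intros continuous_intros simp: norm_divide\<close>)
  then show "c \<le> norm (h 0)"
    using c nz[of 0] by (simp add: norm_divide field_simps)
qed

text \<open>Let \<open>f \<circ> \<gamma> = \<psi> \<circ> f\<close>, and let \<open>a\<close> and \<open>b\<close> be the zeros of \<open>\<gamma>\<close> and \<open>\<psi>\<close>. Write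
  \<open>1 - \<parallel>f z\<parallel>\<^sup>2 = (1 - \<parallel>z\<parallel>\<^sup>2) g(\<parallel>z\<parallel>\<^sup>2)\<close>, where the polynomial \<open>g\<close> has nonnegative
  coefficients. The transformation laws of \<open>\<gamma>\<close> and \<open>\<psi>\<close> contain the common factor
  \<open>1 - \<parallel>z\<parallel>\<^sup>2\<close>, and what remains is
  \<open>(1 - \<parallel>a\<parallel>\<^sup>2) g(\<parallel>\<gamma> z\<parallel>\<^sup>2) \<bar>1 - \<langle>f z, b\<rangle>\<bar>\<^sup>2 = (1 - \<parallel>b\<parallel>\<^sup>2) g(\<parallel>z\<parallel>\<^sup>2) \<bar>1 - \<langle>z, a\<rangle>\<bar>\<^sup>2\<close>.
  This extends continuously to the unit sphere, where both values of \<open>g\<close> are \<open>g(1)\<close>, so the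
  quotient \<open>h\<close> of \<open>1 - \<langle>f z, b\<rangle>\<close> by \<open>1 - \<langle>z, a\<rangle>\<close>, restricted to the complex line of \<open>a\<close>, has
  constant modulus on the circle. It has no zeros, so it has the same modulus at the origin. There the
  identity becomes \<open>g(\<parallel>a\<parallel>\<^sup>2) = g(0)\<close>. A tensor power of degree at least two with nonzero
  coefficient makes \<open>g\<close> strictly increasing at \<open>0\<close>, which forces \<open>a = 0\<close>.\<close>

lemma hermitian_group_juxtaposition_subset:
  fixes e :: "nat \<times> 'n::finite list \<Rightarrow> 'N::finite"
  assumes lam: "(\<Sum>j<k. (cmod (lam j))\<^sup>2) = 1"
    and e: "bij_betw e (juxtaposition_index k m) UNIV"
    and j0: "j0 < k" "2 \<le> m j0" "lam j0 \<noteq> 0"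
    and ball: "\<And>z. norm z < 1 \<Longrightarrow> norm (tensor_juxtaposition k lam m e z) < 1"
  shows "hermitian_group (tensor_juxtaposition k lam m e) \<subseteq> unitary_group"
proof
  let ?f = "tensor_juxtaposition k lam m e"
  fix \<gamma> assume "\<gamma> \<in> hermitian_group ?f"
  then obtain \<psi> where \<gamma>: "\<gamma> \<in> ball_aut" and \<psi>: "\<psi> \<in> ball_aut"
    and eq: "\<And>z. norm z < 1 \<Longrightarrow> ?f (\<gamma> z) = \<psi> (?f z)"
    by (auto simp: hermitian_group_def)
  obtain a where a: "norm a < 1" "\<gamma> a = 0"
    and an: "\<And>z. norm z < 1 \<Longrightarrow> 1 - (norm (\<gamma> z))\<^sup>2
      = (1 - (norm a)\<^sup>2) * (1 - (norm z)\<^sup>2) / (cmod (1 - herm z a))\<^sup>2"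
    using ball_aut_norm[OF \<gamma>] by blast
  obtain b where b: "norm b < 1"
    and bn: "\<And>z. norm z < 1 \<Longrightarrow> 1 - (norm (\<psi> z))\<^sup>2
      = (1 - (norm b)\<^sup>2) * (1 - (norm z)\<^sup>2) / (cmod (1 - herm z b))\<^sup>2"
    using ball_aut_norm[OF \<psi>] by blast
  have a2: "1 - (norm a)\<^sup>2 > 0" and b2: "1 - (norm b)\<^sup>2 > 0"
    using a(1) b by (auto simp: power_less_one_iff)
  define g where "g t = (\<Sum>j<k. (cmod (lam j))\<^sup>2 * (\<Sum>i<m j. t ^ i))" for t :: real
  have fg: "1 - (norm (?f z))\<^sup>2 = (1 - (norm z)\<^sup>2) * g ((norm z)\<^sup>2)" for z
  proof -
    have "1 - (norm (?f z))\<^sup>2 = (\<Sum>j<k. (cmod (lam j))\<^sup>2 * (1 - ((norm z)\<^sup>2) ^ m j))"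
      unfolding norm_tensor_juxtaposition[OF e] using lam
      by (simp add: right_diff_distrib sum_subtractf power_mult)
    also have "\<dots> = (1 - (norm z)\<^sup>2) * g ((norm z)\<^sup>2)"
      unfolding g_def sum_distrib_left
      by (intro sum.cong refl) (subst one_diff_power_eq, simp add: sum_distrib_left algebra_simps)
    finally show ?thesis .
  qed
  have g_less: "g 0 < g t" if "0 < t" for t
    unfolding g_def
  proof (rule sum_strict_mono_ex1)
    have le: "(0::real) ^ i \<le> t ^ i" for i using that by (cases i) auto
    show "\<forall>j\<in>{..<k}. (cmod (lam j))\<^sup>2 * (\<Sum>i<m j. 0 ^ i) \<le> (cmod (lam j))\<^sup>2 * (\<Sum>i<m j. t ^ i)"
      by (intro ballI mult_left_mono sum_mono le) auto
    have "(\<Sum>i<m j0. (0::real) ^ i) < (\<Sum>i<m j0. t ^ i)"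
      by (rule sum_strict_mono_ex1) (use le that j0 in \<open>auto intro!: bexI[of _ 1]\<close>)
    then show "\<exists>j\<in>{..<k}. (cmod (lam j))\<^sup>2 * (\<Sum>i<m j. 0 ^ i) < (cmod (lam j))\<^sup>2 * (\<Sum>i<m j. t ^ i)"
      using j0 by (intro bexI[of _ j0]) auto
  qed simp
  have g1: "g 1 > 0"
  proof -
    have "g 0 \<ge> 0" unfolding g_def by (intro sum_nonneg mult_nonneg_nonneg) auto
    with g_less[of 1] show ?thesis by simp
  qed
  have "a = 0"
  proof (rule ccontr)
    assume a0: "a \<noteq> 0"
    define r where "r = norm a"
    define v where "v = complex_of_real (1 / r) *s a"
    have r: "0 < r" "r < 1" using a0 a by (auto simp: r_def)
    have v: "norm v = 1" using a0 by (simp add: v_def r_def norm_scale_vec norm_divide)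
    have va: "herm (\<zeta> *s v) a = r * \<zeta>" for \<zeta> :: complex
      using r by (simp add: v_def herm_simps herm_self power2_eq_square flip: r_def)
    define q where "q \<zeta> = herm (?f (\<zeta> *s v)) b" for \<zeta> :: complex
    \<comment> \<open>The square of the norm of the image of the point of the line with parameter \<zeta>, in a form that still
      makes sense on the unit circle.\<close>
    define T where "T \<zeta> = 1 - (1 - r\<^sup>2) * (1 - (cmod \<zeta>)\<^sup>2) / (cmod (1 - r * \<zeta>))\<^sup>2" for \<zeta> :: complex
    have nz: "1 - r * \<zeta> \<noteq> 0" if "norm \<zeta> \<le> 1" for \<zeta> :: complex
      using one_minus_herm_nonzero[of "\<zeta> *s v" a] a v that by (simp add: va norm_scale_vec)
    have f_le: "norm (?f z) \<le> 1" if "norm z \<le> 1" for z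
    proof (cases "norm z < 1")
      case False
      with that have "1 - (norm (?f z))\<^sup>2 = 0" unfolding fg by simp
      then show ?thesis using power2_le_imp_le[of "norm (?f z)" 1] by simp
    qed (use ball in \<open>auto intro: less_imp_le\<close>)
    have qnz: "1 - q \<zeta> \<noteq> 0" if "norm \<zeta> \<le> 1" for \<zeta> :: complex
      unfolding q_def by (rule one_minus_herm_nonzero[OF f_le b]) (use that v in \<open>simp add: norm_scale_vec\<close>)
    have main: "(1 - r\<^sup>2) * g (T \<zeta>) * (cmod (1 - q \<zeta>))\<^sup>2
        = (1 - (norm b)\<^sup>2) * g ((cmod \<zeta>)\<^sup>2) * (cmod (1 - r * \<zeta>))\<^sup>2" if \<zeta>: "norm \<zeta> < 1" for \<zeta> :: complex
    proof -
      define z where "z = \<zeta> *s v"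
      have z: "norm z = cmod \<zeta>" "norm z < 1" using \<zeta> v by (simp_all add: z_def norm_scale_vec)
      have G: "1 - (norm (\<gamma> z))\<^sup>2 = (1 - r\<^sup>2) * (1 - (cmod \<zeta>)\<^sup>2) / (cmod (1 - r * \<zeta>))\<^sup>2"
        using an[OF z(2)] z(1) by (simp add: va z_def flip: r_def)
      then have TG: "(norm (\<gamma> z))\<^sup>2 = T \<zeta>" by (simp add: T_def)
      have "(1 - (norm (\<gamma> z))\<^sup>2) * g ((norm (\<gamma> z))\<^sup>2) = 1 - (norm (\<psi> (?f z)))\<^sup>2"
        using eq[OF z(2)] fg by metis
      also have "\<dots> = (1 - (norm b)\<^sup>2) * ((1 - (cmod \<zeta>)\<^sup>2) * g ((cmod \<zeta>)\<^sup>2)) / (cmod (1 - q \<zeta>))\<^sup>2"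
        using bn[OF ball[OF z(2)]] by (simp add: fg z q_def flip: z_def)
      finally have E: "(1 - r\<^sup>2) * (1 - (cmod \<zeta>)\<^sup>2) / (cmod (1 - r * \<zeta>))\<^sup>2 * g (T \<zeta>)
          = (1 - (norm b)\<^sup>2) * ((1 - (cmod \<zeta>)\<^sup>2) * g ((cmod \<zeta>)\<^sup>2)) / (cmod (1 - q \<zeta>))\<^sup>2"
        unfolding G[symmetric] TG[symmetric] .
      have n: "(cmod (1 - r * \<zeta>))\<^sup>2 \<noteq> 0" "(cmod (1 - q \<zeta>))\<^sup>2 \<noteq> 0" "1 - (cmod \<zeta>)\<^sup>2 \<noteq> 0"
        using nz[of \<zeta>] qnz[of \<zeta>] \<zeta> power_less_one_iff[of "cmod \<zeta>" 2] by auto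
      have alg: "x * u / d * y = x' * (u * y') / d' \<Longrightarrow> u \<noteq> 0 \<Longrightarrow> d \<noteq> 0 \<Longrightarrow> d' \<noteq> 0 \<Longrightarrow>
          x * y * d' = x' * y' * d" for x y u d x' y' d' :: real
        by (simp add: field_simps)
      show ?thesis by (rule alg[OF E n(3,1,2)])
    qed
    have cf: "continuous_on (cball 0 1) (\<lambda>\<zeta>. ?f (\<zeta> *s v))"
      by (rule continuous_on_compose2[OF continuous_on_tensor_juxtaposition[OF e, of UNIV]])
        (auto intro: linear_continuous_on bounded_linear_scale_fixed)
    have cq: "continuous_on (cball 0 1) q"
      unfolding q_def by (rule continuous_on_compose2[OF linear_continuous_on[OF bounded_linear_herm, of UNIV] cf]) auto
    \<comment> \<open>The identity on the open disc in a form that passes to the boundary.\<close>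
    define F where "F \<zeta> = (1 - r\<^sup>2) * g (T \<zeta>) * (cmod (1 - q \<zeta>))\<^sup>2
        - (1 - (norm b)\<^sup>2) * g ((cmod \<zeta>)\<^sup>2) * (cmod (1 - r * \<zeta>))\<^sup>2" for \<zeta> :: complex
    have "continuous_on (cball 0 1) F"
      unfolding F_def g_def T_def using nz by (auto intro!: continuous_intros cq)
    then have contF: "continuous_on (closure (ball 0 1)) F" by simp
    have circle: "F \<zeta> = 0" if "norm \<zeta> \<le> 1" for \<zeta>
    proof (rule continuous_constant_on_closure[OF contF])
      show "F x = 0" if "x \<in> ball 0 1" for x
        using main[of x] that by (simp add: F_def)
      show "\<zeta> \<in> closure (ball 0 1)" using that by simp
    qed
    define h where "h \<zeta> = (1 - q \<zeta>) / (1 - r * \<zeta>)" for \<zeta> :: complex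
    have "norm (h 0) = sqrt ((1 - (norm b)\<^sup>2) / (1 - r\<^sup>2))"
    proof (rule cmod_constant_on_circle)
      show "h holomorphic_on ball 0 1"
        unfolding h_def q_def using nz v
        by (intro holomorphic_intros holomorphic_on_slice holomorphic_tensor_juxtaposition[OF e]) auto
      show "continuous_on (cball 0 1) h"
        unfolding h_def using nz by (auto intro!: continuous_intros cq)
      show "h \<zeta> \<noteq> 0" if "norm \<zeta> \<le> 1" for \<zeta> :: complex
        using nz[OF that] qnz[OF that] by (simp add: h_def)
      show "norm (h \<zeta>) = sqrt ((1 - (norm b)\<^sup>2) / (1 - r\<^sup>2))" if \<zeta>: "norm \<zeta> = 1" for \<zeta> :: complex
      proof -
        have "(1 - r\<^sup>2) * (cmod (1 - q \<zeta>))\<^sup>2 = (1 - (norm b)\<^sup>2) * (cmod (1 - r * \<zeta>))\<^sup>2"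
          using circle[of \<zeta>] \<zeta> g1 by (simp add: F_def T_def)
        then have "(norm (h \<zeta>))\<^sup>2 = (1 - (norm b)\<^sup>2) / (1 - r\<^sup>2)"
          using nz[of \<zeta>] \<zeta> a2 by (simp add: h_def norm_divide power_divide r_def field_simps)
        then show ?thesis by (metis norm_ge_zero real_sqrt_unique)
      qed
    qed
    then have "(cmod (1 - q 0))\<^sup>2 = (1 - (norm b)\<^sup>2) / (1 - r\<^sup>2)"
      using a2 b2 by (simp add: h_def r_def)
    moreover have "(1 - r\<^sup>2) * g (r\<^sup>2) * (cmod (1 - q 0))\<^sup>2 = (1 - (norm b)\<^sup>2) * g 0"
      using main[of 0] by (simp add: T_def)
    ultimately have "g (r\<^sup>2) = g 0"
      using a2 b2 by (simp add: r_def)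
    with g_less[of "r\<^sup>2"] r show False by simp
  qed
  with a \<gamma> show "\<gamma> \<in> unitary_group" by (intro ball_aut_fixing_0_unitary) auto
qed

lemma hermitian_group_juxtaposition_unitary:
  fixes e :: "nat \<times> 'n::finite list \<Rightarrow> 'N::finite"
  assumes lam: "(\<Sum>j<k. (cmod (lam j))\<^sup>2) = 1"
    and e: "bij_betw e (juxtaposition_index k m) UNIV"
    and j: "\<exists>j<k. 2 \<le> m j \<and> lam j \<noteq> 0"
  shows "hermitian_group (tensor_juxtaposition k lam m e) = unitary_group"
proof -
  have "proper_holomorphic_ball_map (tensor_juxtaposition k lam m e)"
    unfolding proper_tensor_juxtaposition_iff[OF lam e] using j by fastforce
  note ball = tensor_juxtaposition_maps_ball[OF this]
  show ?thesis
    using j hermitian_group_juxtaposition_subset[OF lam e _ _ _ ball]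
      unitary_group_subset_hermitian_group[OF e ball] by blast
qed

text \<open>A single tensor power is a juxtaposition with one summand.\<close>

lemma hermitian_group_tensor_map:
  fixes e' :: "'n::finite list \<Rightarrow> 'M::finite"
  assumes "2 \<le> d" "bij_betw e' (words d) UNIV"
  shows "hermitian_group (tensor_map d e') = unitary_group"
proof -
  let ?I = "juxtaposition_index 1 (\<lambda>_. d) :: (nat \<times> 'n list) set"
  let ?e = "\<lambda>p :: nat \<times> 'n list. e' (snd p)"
  have I: "?I = Pair 0 ` words d" by (auto simp: juxtaposition_index_def)
  have e: "bij_betw ?e ?I UNIV"
    using assms(2) unfolding I bij_betw_def by (auto simp: inj_on_def image_image)
  have "inv_into ?I ?e x = (0, inv_into (words d) e' x)" for x
  proof (rule inv_into_f_eq)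
    show "inj_on ?e ?I" using e by (simp add: bij_betw_def)
    show "(0, inv_into (words d) e' x) \<in> ?I"
      using bij_betwE[OF bij_betw_inv_into[OF assms(2)]] unfolding I by blast
    show "?e (0, inv_into (words d) e' x) = x"
      using bij_betw_inv_into_right[OF assms(2)] by simp
  qed
  then have "tensor_map d e' = tensor_juxtaposition 1 (\<lambda>_. 1) (\<lambda>_. d) ?e"
    by (simp add: fun_eq_iff tensor_map_def tensor_juxtaposition_def enumerate_coords_def juxtaposition_def)
  then show ?thesis
    using hermitian_group_juxtaposition_unitary[of "\<lambda>_. 1" 1 ?e "\<lambda>_. d"] e assms(1) by simp
qed

section \<open>Source rank\<close>

text \<open>The truncated subtraction on the right covers the lists without a positive entry.\<close>

lemma sum_list_pred_le: "(\<Sum>k\<leftarrow>filter (\<lambda>k. k \<ge> 1) ks. k - 1) \<le> sum_list ks - (1 :: nat)"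
  by (induction ks) auto

lemma block_source_rank_pos:
  assumes "sum_list ks \<le> n" "0 < n"
  shows "1 \<le> block_source_rank n ks"
  using sum_list_pred_le[of ks] assms unfolding block_source_rank_def by linarith

lemma coord_pos_less: "coord_pos (i :: 'n::{finite,linorder}) < CARD('n)"
  unfolding coord_pos_def by (rule psubset_card_mono) auto

lemma block_unitary_group_full:
  "block_unitary_group [CARD('n)] = (unitary_group :: (complex^'n::{finite,linorder} \<Rightarrow> complex^'n::{finite,linorder}) set)"
proof -
  have "block [CARD('n)] 0 = (UNIV :: 'n set)"
    using coord_pos_less by (auto simp: block_def)
  then show ?thesis by (simp add: block_unitary_group_def unitary_group_def)
qed

lemma unitary_identity: "linear_ball_map (mat 1) \<in> unitary_group"
proof -
  have "conjugate_transpose (mat 1 :: complex^'a^'a) = mat 1"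
    by (simp add: conjugate_transpose_def mat_def vec_eq_iff)
  then show ?thesis by (auto simp: unitary_group_def unitary_matrix_def)
qed

text \<open>The identity alone is the block group of the empty list, so the minimum is taken over a nonempty set,
  and all its elements are positive.\<close>

lemma group_source_rank_pos:
  fixes \<Gamma> :: "(complex^'n::{finite,linorder} \<Rightarrow> complex^'n::{finite,linorder}) set"
  assumes "linear_ball_map (mat 1) \<in> \<Gamma>"
  shows "1 \<le> group_source_rank \<Gamma>"
proof -
  let ?P = "\<lambda>s. \<exists>ks. sum_list ks \<le> CARD('n) \<and> block_unitary_group ks \<subseteq> \<Gamma> \<and> s = block_source_rank CARD('n) ks"
  have "block_unitary_group [] \<subseteq> \<Gamma>"
  proof -
    have "A = mat 1" if "\<forall>i l. A $ i $ l = mat 1 $ i $ l" for A :: "((complex, 'n) vec, 'n) vec"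
      using that by (simp add: vec_eq_iff)
    then show ?thesis using assms by (auto simp: block_unitary_group_def)
  qed
  then have "?P (block_source_rank CARD('n) [])" by (intro exI[of _ "[]"]) simp
  then have "?P (group_source_rank \<Gamma>)"
    unfolding group_source_rank_def by (rule LeastI)
  then show ?thesis using block_source_rank_pos[of _ "CARD('n)"] by auto
qed

text \<open>The full unitary group is the block group with one block, of source rank 1. No conjugate of
  the group has a smaller source rank: it contains the identity, so its source rank is attained at some
  block group and is positive.\<close>

lemma source_rank_eq_1:
  fixes f :: "complex^'n::{finite,linorder} \<Rightarrow> complex^'N"
  assumes U: "unitary_group \<subseteq> hermitian_group f"
  shows "source_rank f = 1"
proof -
  let ?B = "ball (0 :: (complex, 'n) vec) 1"
  let ?id = "linear_ball_map (mat 1) :: (complex, 'n) vec \<Rightarrow> (complex, 'n) vec"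
  have id_apply: "?id z = z" if "z \<in> ?B" for z using that by (simp add: linear_ball_map_def)
  have id: "?id \<in> ball_aut" using unitary_identity unitary_group_subset_ball_aut by auto
  have pos: "1 \<le> group_source_rank (conjugate_group \<phi> (hermitian_group f))" if \<phi>: "\<phi> \<in> ball_aut" for \<phi>
  proof (rule group_source_rank_pos)
    have "?id \<in> hermitian_group f" using U unitary_identity by auto
    moreover have "compose ?B (inv_into ?B \<phi>) (compose ?B ?id \<phi>) = ?id"
    proof (rule extensionalityI)
      show "?id \<in> extensional ?B" by (simp add: linear_ball_map_def)
      show "compose ?B (inv_into ?B \<phi>) (compose ?B ?id \<phi>) z = ?id z" if "z \<in> ?B" for z
        using that ball_autD(3,5)[OF \<phi>, of z] by (simp add: compose_def id_apply)
    qed (simp add: compose_extensional)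
    ultimately show "?id \<in> conjugate_group \<phi> (hermitian_group f)"
      by (force simp: conjugate_group_def)
  qed
  have conj_id: "conjugate_group ?id (hermitian_group f) = hermitian_group f"
  proof -
    have "compose ?B (inv_into ?B ?id) (compose ?B \<gamma> ?id) = \<gamma>" if "\<gamma> \<in> hermitian_group f" for \<gamma>
    proof -
      have \<gamma>: "\<gamma> \<in> ball_aut" using that by (simp add: hermitian_group_def)
      show ?thesis
      proof (rule extensionalityI)
        show "compose ?B (inv_into ?B ?id) (compose ?B \<gamma> ?id) z = \<gamma> z" if "z \<in> ?B" for z
          using that ball_autD(3)[OF \<gamma>, of z] ball_autD(5)[OF id, of "\<gamma> z"]
          by (simp add: compose_def id_apply)
      qed (use ball_autD(7)[OF \<gamma>] in \<open>auto simp: compose_extensional\<close>)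
    qed
    then show ?thesis by (simp add: conjugate_group_def)
  qed
  have "group_source_rank (hermitian_group f) \<le> 1"
    unfolding group_source_rank_def
    by (rule Least_le, rule exI[of _ "[CARD('n)]"])
      (use U in \<open>simp add: block_unitary_group_full block_source_rank_def\<close>)
  then have "group_source_rank (conjugate_group ?id (hermitian_group f)) = 1"
    using pos[OF id] by (simp add: conj_id)
  then show ?thesis
    unfolding source_rank_def using id pos by (intro Least_equality) (metis, blast)
qed

theorem theorem4p2:
  fixes k :: nat
    and lam :: "nat \<Rightarrow> complex"
    and m :: "nat \<Rightarrow> nat"
    and e :: "nat \<times> 'n::{finite,linorder} list \<Rightarrow> 'N::finite"
  assumes "(\<Sum>j<k. (cmod (lam j))\<^sup>2) = 1"
    and "inj_on m {..<k}"
    and "bij_betw e (juxtaposition_index k m) UNIV"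
    and "proper_holomorphic_ball_map (tensor_juxtaposition k lam m e)"
  shows
    "hermitian_group (\<lambda>z :: complex^'n::{finite,linorder}. z) = ball_aut \<and>
     (\<forall>d (e' :: 'n list \<Rightarrow> 'M::finite). 2 \<le> d \<and> bij_betw e' (words d) UNIV \<longrightarrow>
        hermitian_group (tensor_map d e') = unitary_group) \<and>
     ((\<exists>j<k. 2 \<le> m j \<and> lam j \<noteq> 0) \<longrightarrow>
        hermitian_group (tensor_juxtaposition k lam m e) = unitary_group) \<and>
     (k = 2 \<and> m 0 = 0 \<and> m 1 = 1 \<longrightarrow>
        hermitian_group (tensor_juxtaposition k lam m e) = ball_aut) \<and>
     source_rank (\<lambda>z :: complex^'n::{finite,linorder}. z) = 1 \<and>
     (\<forall>d (e' :: 'n list \<Rightarrow> 'M::finite). 2 \<le> d \<and> bij_betw e' (words d) UNIV \<longrightarrow>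
        source_rank (tensor_map d e') = 1) \<and>
     ((\<exists>j<k. 2 \<le> m j \<and> lam j \<noteq> 0) \<or> (k = 2 \<and> m 0 = 0 \<and> m 1 = 1) \<longrightarrow>
        source_rank (tensor_juxtaposition k lam m e) = 1)"
proof -
  note unitary = hermitian_group_juxtaposition_unitary[OF assms(1,3)]
  note aut = hermitian_group_juxtaposition_0_1[OF assms(1,3,4)]
  have U: "unitary_group \<subseteq> hermitian_group (tensor_juxtaposition k lam m e)"
    by (rule unitary_group_subset_hermitian_group[OF assms(3) tensor_juxtaposition_maps_ball[OF assms(4)]])
  have "source_rank (\<lambda>z :: complex^'n::{finite,linorder}. z) = 1"
    by (rule source_rank_eq_1) (simp add: hermitian_group_identity unitary_group_subset_ball_aut)
  then show ?thesis
    using unitary aut source_rank_eq_1[OF U]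
    by (auto simp: hermitian_group_identity hermitian_group_tensor_map source_rank_eq_1)
qed

end
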